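(* Let $f$ satisfy (f1) and suppose $f_0=0$ and $f_\infty\in(0,+\infty)$. Then for every $\lambda\in(\lambda_1/f_\infty,+\infty)$, problem (MO) has two solutions $u^+$ and $u^-$ such that $u^+$ is positive and strictly concave in $(0,1)$ and $u^-$ is negative and strictly convex in $(0,1)$.
   Context: Let $N\ge 1$ be an integer and $f:\mathbb{R}\to\mathbb{R}$ continuous. For $\lambda\ge 0$, problem (MO) is: find $u\in C^2[0,1]$ with $\left((u'(r))^N\right)'=\lambda^N N r^{N-1} f(-u(r))$ for $0<r<1$ and $u'(0)=u(1)=0$. Condition (f1): $f\in C(\mathbb{R},\mathbb{R})$ and $f(s)s^N>0$ for all $s\neq0$. The quantities $f_0,f_\infty\in[0,+\infty]$ are defined by $f_0^N=\lim_{s\to0} f(s)/s^N$ and $f_\infty^N=\lim_{|s|\to+\infty} f(s)/s^N$ (limits assumed to exist in $[0,+\infty]$). $\lambda_1>0$ denotes the first eigenvalue of $\left((-v')^N\right)'=\lambda^N N r^{N-1}v^N$ in $(0,1)$, $v'(0)=v(1)=0$, i.e. the unique $\lambda>0$ for which this problem has a solution $v\in C^2[0,1]$ positive in $(0,1)$. *)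

theory Defs
  imports "HOL-Analysis.Analysis"
begin

definition C2_with_deriv :: "(real \<Rightarrow> real) \<Rightarrow> (real \<Rightarrow> real) \<Rightarrow> bool" where
  "C2_with_deriv u u' \<longleftrightarrow>
     (\<exists>u''. continuous_on {0..1} u' \<and> continuous_on {0..1} u'' \<and>
        (\<forall>r\<in>{0..1}. (u has_real_derivative u' r) (at r within {0..1})) \<and>
        (\<forall>r\<in>{0..1}. (u' has_real_derivative u'' r) (at r within {0..1})))"

definition MO_solution :: "nat \<Rightarrow> (real \<Rightarrow> real) \<Rightarrow> real \<Rightarrow> (real \<Rightarrow> real) \<Rightarrow> bool" where
  "MO_solution N f lam u \<longleftrightarrow>
     (\<exists>u'. C2_with_deriv u u' \<and>
        (\<forall>r\<in>{0<..<1}. ((\<lambda>t. (u' t) ^ N) has_real_derivative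
              lam ^ N * real N * r ^ (N - 1) * f (- u r)) (at r)) \<and>
        u' 0 = 0 \<and> u 1 = 0)"

definition has_pos_eigenfunction :: "nat \<Rightarrow> real \<Rightarrow> bool" where
  "has_pos_eigenfunction N lam \<longleftrightarrow>
     (\<exists>v v'. C2_with_deriv v v' \<and>
        (\<forall>r\<in>{0<..<1}. ((\<lambda>t. (- v' t) ^ N) has_real_derivative
              lam ^ N * real N * r ^ (N - 1) * (v r) ^ N) (at r)) \<and>
        v' 0 = 0 \<and> v 1 = 0 \<and> (\<forall>r\<in>{0<..<1}. v r > 0))"

definition lambda1 :: "nat \<Rightarrow> real" where
  "lambda1 N = (THE lam. lam > 0 \<and> has_pos_eigenfunction N lam)"

definition strictly_convex_on :: "real set \<Rightarrow> (real \<Rightarrow> real) \<Rightarrow> bool" where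
  "strictly_convex_on S g \<longleftrightarrow>
     (\<forall>x\<in>S. \<forall>y\<in>S. \<forall>t. x \<noteq> y \<and> 0 < t \<and> t < 1 \<longrightarrow>
        g (t * x + (1 - t) * y) < t * g x + (1 - t) * g y)"

definition strictly_concave_on :: "real set \<Rightarrow> (real \<Rightarrow> real) \<Rightarrow> bool" where
  "strictly_concave_on S g \<longleftrightarrow> strictly_convex_on S (\<lambda>x. - g x)"

end

theory Submission
  imports Defs "HOL-Complex_Analysis.Great_Picard"
begin

text \<open>
  With \<open>w = \<bar>u\<bar>\<close> and a nonnegative nonlinearity \<open>h\<close>, both problems become
  \<open>w r = d - \<integral>\<^sub>0\<^sup>r (\<integral>\<^sub>0\<^sup>t N s\<^sup>N\<^sup>-\<^sup>1 h (w s) ds)\<^sup>1\<^sup>/\<^sup>N dt\<close> together with \<open>w 1 = 0\<close>, and one shoots in the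
  height \<open>d\<close>. As \<open>h\<close> is merely continuous, initial value problems need not be uniquely solvable;
  Tonelli's delayed equations are, with continuous dependence on \<open>d\<close>, so the shooting is done for them
  and Arzela-Ascoli yields a solution as the delay tends to 0. For small \<open>d\<close> the value at 1 is positive
  because \<open>f\<^sub>0 = 0\<close>. For large \<open>d\<close> a solution nonnegative at 1 would, on an interval
  \<open>[0, \<rho>]\<close> with \<open>\<rho>\<close> close to 1, be a positive supersolution of the eigenvalue problem with parameter
  above \<open>\<lambda>\<^sub>1\<close>, which monotonicity and homogeneity exclude.
\<close>

section \<open>The integral operator\<close>

text \<open>\<open>flux\<close> is the once integrated equation: for a fixed point \<open>w\<close>
  of \<open>shoot\<close>, \<open>slope\<close> is \<open>- w'\<close> and \<open>flux\<close> is
  \<open>(- w') ^ N\<close>. The inserted function \<open>y\<close> stays separate from the result,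
  so that delayed arguments can be substituted.\<close>

definition flux :: "nat \<Rightarrow> (real \<Rightarrow> real) \<Rightarrow> (real \<Rightarrow> real) \<Rightarrow> real \<Rightarrow> real" where
  "flux N h y t = integral {0..t} (\<lambda>s. real N * s ^ (N - 1) * h (y s))"

definition slope :: "nat \<Rightarrow> (real \<Rightarrow> real) \<Rightarrow> (real \<Rightarrow> real) \<Rightarrow> real \<Rightarrow> real" where
  "slope N h y t = root N (flux N h y t)"

definition shoot :: "nat \<Rightarrow> (real \<Rightarrow> real) \<Rightarrow> real \<Rightarrow> (real \<Rightarrow> real) \<Rightarrow> real \<Rightarrow> real" where
  "shoot N h d y r = d - integral {0..r} (slope N h y)"

lemma weight_has_integral:
  assumes "0 \<le> (t::real)" "N \<ge> 1"
  shows "((\<lambda>s. real N * s ^ (N - 1)) has_integral t ^ N) {0..t}"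
proof -
  have "((\<lambda>s. real N * s ^ (N - 1)) has_integral t ^ N - 0 ^ N) {0..t}"
    by (rule fundamental_theorem_of_calculus[OF assms(1)])
       (auto intro!: derivative_eq_intros simp flip: has_real_derivative_iff_has_vector_derivative)
  with assms show ?thesis by (simp add: power_0_left)
qed

text \<open>Nonnegativity of \<open>h\<close> makes \<open>flux\<close> and \<open>slope\<close>
  nonnegative and nondecreasing, hence every shot nonincreasing and concave on
  \<open>{0..1}\<close>, whatever continuous \<open>y\<close> is inserted.\<close>

locale radial =
  fixes N :: nat and h :: "real \<Rightarrow> real"
  assumes N_ge: "N \<ge> 1"
    and h_cont: "continuous_on UNIV h"
    and h_nonneg: "0 \<le> h s"
begin

lemma N_pos: "0 < N" using N_ge by simp

lemma continuous_on_h_comp: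
  "continuous_on S y \<Longrightarrow> continuous_on S (\<lambda>s. h (y s))"
  by (rule continuous_on_compose2[OF h_cont]) auto

lemma continuous_on_density:
  "continuous_on S y \<Longrightarrow> continuous_on S (\<lambda>s. real N * s ^ (N - 1) * h (y s))"
  by (intro continuous_intros continuous_on_h_comp)

lemma density_integrable:
  assumes "continuous_on {0..1} y" "0 \<le> a" "b \<le> 1"
  shows "(\<lambda>s. real N * s ^ (N - 1) * h (y s)) integrable_on {a..b}"
  using assms
  by (intro integrable_continuous_interval continuous_on_density)
     (auto intro: continuous_on_subset)

lemma flux_0 [simp]: "flux N h y 0 = 0"
  by (simp add: flux_def)

lemma slope_0 [simp]: "slope N h y 0 = 0"
  by (simp add: slope_def)

lemma shoot_0 [simp]: "shoot N h d y 0 = d"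
  by (simp add: shoot_def)

section \<open>Derivative, bounds and monotonicity of flux and slope\<close>

lemma flux_has_derivative:
  assumes "continuous_on {0..1} y" "t \<in> {0..1}"
  shows "(flux N h y has_real_derivative real N * t ^ (N - 1) * h (y t)) (at t within {0..1})"
  using integral_has_real_derivative[OF continuous_on_density[OF assms(1)] assms(2)]
  by (simp add: flux_def[abs_def])

lemma flux_has_integral:
  assumes "continuous_on {0..1} y" "t \<in> {0..1}"
  shows "((\<lambda>s. real N * s ^ (N - 1) * h (y s)) has_integral flux N h y t) {0..t}"
  unfolding flux_def using density_integrable[OF assms(1), of 0 t] assms(2)
  by (simp add: integrable_integral)

lemma const_flux_has_integral:
  assumes "t \<in> {0..1}"
  shows "((\<lambda>s. real N * s ^ (N - 1) * M) has_integral M * t ^ N) {0..t}"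
  using has_integral_mult_left[OF weight_has_integral[of t N], of M] assms N_ge
  by (simp add: mult.commute)

lemma flux_upper:
  assumes "continuous_on {0..1} y" "t \<in> {0..1}" "\<And>s. s \<in> {0..t} \<Longrightarrow> h (y s) \<le> M"
  shows "flux N h y t \<le> M * t ^ N"
  by (rule has_integral_le[OF flux_has_integral[OF assms(1,2)] const_flux_has_integral[OF assms(2)]])
     (use assms(3) in \<open>auto intro!: mult_left_mono\<close>)

lemma flux_lower:
  assumes "continuous_on {0..1} y" "t \<in> {0..1}" "\<And>s. s \<in> {0..t} \<Longrightarrow> M \<le> h (y s)"
  shows "M * t ^ N \<le> flux N h y t"
  by (rule has_integral_le[OF const_flux_has_integral[OF assms(2)] flux_has_integral[OF assms(1,2)]])
     (use assms(3) in \<open>auto intro!: mult_left_mono\<close>)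

lemma flux_mono:
  assumes "continuous_on {0..1} y" "0 \<le> s" "s \<le> t" "t \<le> 1"
  shows "flux N h y s \<le> flux N h y t"
  unfolding flux_def
  using assms density_integrable[OF assms(1)] h_nonneg
  by (intro integral_subset_le) auto

lemma flux_nonneg:
  assumes "continuous_on {0..1} y" "0 \<le> t" "t \<le> 1"
  shows "0 \<le> flux N h y t"
  using flux_mono[OF assms(1) order_refl assms(2,3)] by simp

lemma slope_mono:
  assumes "continuous_on {0..1} y" "0 \<le> s" "s \<le> t" "t \<le> 1"
  shows "slope N h y s \<le> slope N h y t"
  using flux_mono[OF assms] N_pos by (simp add: slope_def)

lemma slope_nonneg:
  assumes "continuous_on {0..1} y" "0 \<le> t" "t \<le> 1"
  shows "0 \<le> slope N h y t"
  using flux_nonneg[OF assms] by (simp add: slope_def real_root_ge_zero)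

lemma slope_power:
  assumes "continuous_on {0..1} y" "0 \<le> t" "t \<le> 1"
  shows "slope N h y t ^ N = flux N h y t"
  using flux_nonneg[OF assms] N_pos by (simp add: slope_def)

text \<open>The weight integrates to \<open>t ^ N\<close>, so taking the root turns a constant bound
  on \<open>h\<close> into a bound linear in \<open>t\<close>.\<close>

lemma slope_upper:
  assumes "continuous_on {0..1} y" "t \<in> {0..1}" "\<And>s. s \<in> {0..t} \<Longrightarrow> h (y s) \<le> M"
  shows "slope N h y t \<le> root N M * t"
proof -
  have "slope N h y t \<le> root N (M * t ^ N)"
    using flux_upper[OF assms] N_pos by (simp add: slope_def)
  also have "\<dots> = root N M * t"
    using assms(2) N_pos by (simp add: real_root_mult real_root_power_cancel)
  finally show ?thesis .
qed

lemma slope_lower: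
  assumes "continuous_on {0..1} y" "t \<in> {0..1}" "\<And>s. s \<in> {0..t} \<Longrightarrow> M \<le> h (y s)"
  shows "root N M * t \<le> slope N h y t"
proof -
  have "root N M * t = root N (M * t ^ N)"
    using assms(2) N_pos by (simp add: real_root_mult real_root_power_cancel)
  also have "\<dots> \<le> slope N h y t"
    using flux_lower[OF assms] N_pos by (simp add: slope_def)
  finally show ?thesis .
qed

lemma continuous_on_flux:
  assumes "continuous_on {0..1} y"
  shows "continuous_on {0..1} (flux N h y)"
  by (rule DERIV_continuous_on[OF flux_has_derivative[OF assms]])

lemma continuous_on_slope:
  assumes "continuous_on {0..1} y"
  shows "continuous_on {0..1} (slope N h y)"
  unfolding slope_def[abs_def] by (intro continuous_intros continuous_on_flux assms)

lemma slope_integrable: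
  assumes "continuous_on {0..1} y" "0 \<le> a" "b \<le> 1"
  shows "slope N h y integrable_on {a..b}"
  using assms
  by (intro integrable_continuous_interval continuous_on_subset[OF continuous_on_slope]) auto

section \<open>Monotonicity, concavity and continuity of shots\<close>

lemma shoot_has_derivative:
  assumes "continuous_on {0..1} y" "t \<in> {0..1}"
  shows "(shoot N h d y has_real_derivative - slope N h y t) (at t within {0..1})"
  unfolding shoot_def[abs_def]
  using integral_has_real_derivative[OF continuous_on_slope[OF assms(1)] assms(2)]
  by (auto intro!: derivative_eq_intros)

lemma continuous_on_shoot:
  assumes "continuous_on {0..1} y"
  shows "continuous_on {0..1} (shoot N h d y)"
  by (rule DERIV_continuous_on[OF shoot_has_derivative[OF assms]])

lemma shoot_diff:
  assumes "continuous_on {0..1} y" "0 \<le> s" "s \<le> t" "t \<le> 1"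
  shows "shoot N h d y s - shoot N h d y t = integral {s..t} (slope N h y)"
  using Henstock_Kurzweil_Integration.integral_combine[of 0 s t "slope N h y"] slope_integrable[OF assms(1), of 0 t] assms
  by (simp add: shoot_def)

lemma shoot_drop_lower:
  assumes "continuous_on {0..1} y" "0 \<le> s" "s \<le> t" "t \<le> 1"
  shows "(t - s) * slope N h y s \<le> shoot N h d y s - shoot N h d y t"
proof -
  have "integral {s..t} (\<lambda>_. slope N h y s) \<le> integral {s..t} (slope N h y)"
    using assms slope_mono[OF assms(1,2)] slope_integrable[OF assms(1)] by (intro integral_le) auto
  then show ?thesis using shoot_diff[OF assms] assms by simp
qed

lemma shoot_drop_upper:
  assumes "continuous_on {0..1} y" "0 \<le> s" "s \<le> t" "t \<le> 1"
  shows "shoot N h d y s - shoot N h d y t \<le> (t - s) * slope N h y t"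
proof -
  have "integral {s..t} (slope N h y) \<le> integral {s..t} (\<lambda>_. slope N h y t)"
    using assms slope_mono[OF assms(1)] slope_integrable[OF assms(1)] by (intro integral_le) auto
  then show ?thesis using shoot_diff[OF assms] assms by simp
qed

lemma shoot_antimono:
  assumes "continuous_on {0..1} y" "0 \<le> s" "s \<le> t" "t \<le> 1"
  shows "shoot N h d y t \<le> shoot N h d y s"
proof -
  have "0 \<le> (t - s) * slope N h y s"
    using slope_nonneg[of y s] assms by simp
  then show ?thesis
    using shoot_drop_lower[OF assms, of d] by linarith
qed

lemma shoot_le:
  assumes "continuous_on {0..1} y" "r \<in> {0..1}"
  shows "shoot N h d y r \<le> d"
  using shoot_antimono[of y 0 r d] assms by simp

text \<open>This is concavity: the slope at \<open>r\<close> bounds the mean drop from above on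
  \<open>{0..r}\<close> and from below on \<open>{r..1}\<close>. With the weights
  \<open>1 - r\<close> and \<open>r\<close> the slope cancels between the two bounds.\<close>

lemma shoot_above_chord:
  assumes "continuous_on {0..1} y" "r \<in> {0..1}"
  shows "r * shoot N h d y 1 + (1 - r) * d \<le> shoot N h d y r"
proof -
  define a where "a = shoot N h d y r"
  have "(1 - r) * slope N h y r \<le> a - shoot N h d y 1" "d - a \<le> r * slope N h y r"
    using shoot_drop_lower[of y r 1 d] shoot_drop_upper[of y 0 r d] assms by (auto simp: a_def)
  then have "r * ((1 - r) * slope N h y r) \<le> r * (a - shoot N h d y 1)"
    "(1 - r) * (d - a) \<le> (1 - r) * (r * slope N h y r)"
    using assms(2) by (auto intro!: mult_left_mono)
  then show ?thesis
    unfolding a_def[symmetric] by (simp add: algebra_simps)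
qed

text \<open>Dominated convergence is applied to both integrals; the common bound \<open>M\<close> on
  \<open>h\<close> supplies the majorants, so pointwise convergence of the inserted functions is
  enough.\<close>

lemma shoot_tendsto:
  assumes yc: "\<And>n. continuous_on {0..1} (y n)" and zc: "continuous_on {0..1} z"
    and lim: "\<And>s. s \<in> {0..1} \<Longrightarrow> (\<lambda>n. y n s) \<longlonglongrightarrow> z s"
    and bound: "\<And>n s. s \<in> {0..1} \<Longrightarrow> h (y n s) \<le> M"
    and d: "d \<longlonglongrightarrow> e" and r: "r \<in> {0..1}"
  shows "(\<lambda>n. shoot N h (d n) (y n) r) \<longlonglongrightarrow> shoot N h e z r"
proof -
  have flux_lim: "(\<lambda>n. flux N h (y n) t) \<longlonglongrightarrow> flux N h z t" if t: "t \<in> {0..1}" for t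
    unfolding flux_def
  proof (rule dominated_convergence(2))
    show "(\<lambda>s. real N * s ^ (N - 1) * M) integrable_on {0..t}"
      by (intro integrable_continuous_interval continuous_intros)
    fix n s assume s: "s \<in> {0..t}"
    show "norm (real N * s ^ (N - 1) * h (y n s)) \<le> real N * s ^ (N - 1) * M"
      using bound[of s n] h_nonneg s t by (auto simp: abs_mult intro!: mult_left_mono)
    have "(\<lambda>k. h (y k s)) \<longlonglongrightarrow> h (z s)"
      using s t by (intro continuous_on_tendsto_compose[OF h_cont] lim) auto
    then show "(\<lambda>k. real N * s ^ (N - 1) * h (y k s)) \<longlonglongrightarrow> real N * s ^ (N - 1) * h (z s)"
      by (intro tendsto_intros)
  qed (use t density_integrable[OF yc] in auto)
  have "(\<lambda>n. integral {0..r} (slope N h (y n))) \<longlonglongrightarrow> integral {0..r} (slope N h z)"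
  proof (rule dominated_convergence(2))
    show "(\<lambda>s. root N M * s) integrable_on {0..r}"
      by (intro integrable_continuous_interval continuous_intros)
    fix n s assume s: "s \<in> {0..r}"
    then show "norm (slope N h (y n) s) \<le> root N M * s"
      using slope_upper[OF yc, of s n M] slope_nonneg[OF yc, of s n] bound r by auto
    show "(\<lambda>k. slope N h (y k) s) \<longlonglongrightarrow> slope N h z s"
      unfolding slope_def using s r by (intro tendsto_intros flux_lim) auto
  qed (use r slope_integrable[OF yc] in auto)
  then show ?thesis
    unfolding shoot_def by (intro tendsto_intros d)
qed

end

section \<open>Tonelli approximation\<close>

text \<open>Iterating from the constant \<open>d\<close> solves the delayed equation step by step:
  the \<open>k\<close>-th iterate is final on \<open>{0..k * \<delta>}\<close>. Below 0 the delayed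
  argument is frozen, where the value is the starting height.\<close>

primrec tonelli :: "nat \<Rightarrow> (real \<Rightarrow> real) \<Rightarrow> real \<Rightarrow> real \<Rightarrow> nat \<Rightarrow> real \<Rightarrow> real" where
  "tonelli N h \<delta> d 0 = (\<lambda>r. d)"
| "tonelli N h \<delta> d (Suc k) = shoot N h d (\<lambda>s. tonelli N h \<delta> d k (max 0 (s - \<delta>)))"

text \<open>\<open>Suc n\<close> steps of length \<open>1 / Suc n\<close> are just enough to cover
  \<open>{0..1}\<close>.\<close>

definition approximant :: "nat \<Rightarrow> (real \<Rightarrow> real) \<Rightarrow> nat \<Rightarrow> real \<Rightarrow> real \<Rightarrow> real" where
  "approximant N h n d = tonelli N h (1 / real (Suc n)) d (Suc n)"

lemma shoot_cong:
  assumes "\<And>s. s \<in> {0..r} \<Longrightarrow> y s = z s"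
  shows "shoot N h d y r = shoot N h d z r"
proof -
  have "flux N h y t = flux N h z t" if "t \<in> {0..r}" for t
    unfolding flux_def using assms that by (intro integral_cong) auto
  then show ?thesis
    unfolding shoot_def slope_def by (intro arg_cong2[where f = minus] refl integral_cong) auto
qed

lemma continuous_on_delay:
  assumes "continuous_on {0..1} y" "0 \<le> (\<delta>::real)"
  shows "continuous_on {0..1} (\<lambda>s. y (max 0 (s - \<delta>)))"
  by (rule continuous_on_compose2[OF assms(1)]) (use assms(2) in \<open>auto intro!: continuous_intros\<close>)

text \<open>Vanishing below 0 makes \<open>h\<close> bounded above on every half line
  \<open>{..b}\<close>. Shots that drop below 0 therefore stay under the same bound as those that
  remain positive.\<close>

locale forcing = radial +
  assumes h_nonpos: "s \<le> 0 \<Longrightarrow> h s = 0"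
    and h_pos: "0 < s \<Longrightarrow> 0 < h s"
begin

lemma h_bounded_above:
  obtains M where "0 \<le> M" "\<And>s. s \<le> b \<Longrightarrow> h s \<le> M"
proof -
  have "compact (h ` {0..b})"
    by (intro compact_continuous_image compact_Icc continuous_on_subset[OF h_cont]) auto
  then obtain B where B: "\<And>s. s \<in> {0..b} \<Longrightarrow> \<bar>h s\<bar> \<le> B"
    using compact_imp_bounded by (fastforce simp: bounded_iff)
  show ?thesis
  proof (rule that[of "max 0 B"])
    show "h s \<le> max 0 B" if "s \<le> b" for s
      using B[of s] h_nonpos[of s] that by (cases "s \<le> 0") auto
  qed auto
qed

lemma continuous_on_tonelli:
  assumes "0 \<le> \<delta>"
  shows "continuous_on {0..1} (tonelli N h \<delta> d k)"
  by (induction k) (auto intro!: continuous_intros continuous_on_shoot continuous_on_delay assms)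

lemma tonelli_le:
  assumes "0 \<le> \<delta>" "r \<in> {0..1}"
  shows "tonelli N h \<delta> d k r \<le> d"
  using assms
  by (cases k) (auto intro!: shoot_le continuous_on_delay continuous_on_tonelli)

text \<open>Up to \<open>r\<close>, an iterate reads its predecessor only up to
  \<open>r - \<delta>\<close>, so each iteration extends the interval of agreement by one
  delay.\<close>

lemma tonelli_stable:
  assumes "0 \<le> \<delta>" "0 \<le> r" "r \<le> real k * \<delta>"
  shows "tonelli N h \<delta> d (Suc k) r = tonelli N h \<delta> d k r"
  using assms(2,3)
proof (induction k arbitrary: r)
  case 0
  then show ?case by simp
next
  case (Suc k)
  have "tonelli N h \<delta> d (Suc k) (max 0 (s - \<delta>)) = tonelli N h \<delta> d k (max 0 (s - \<delta>))"
    if "s \<in> {0..r}" for s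
    using Suc.prems that assms(1) by (intro Suc.IH) (auto simp: algebra_simps)
  then show ?case
    unfolding tonelli.simps(2)[of N h \<delta> d "Suc k"] tonelli.simps(2)[of N h \<delta> d k]
    by (intro shoot_cong) simp
qed

text \<open>Each iterate is an explicit function of the previous one, so continuous dependence on
  the height passes through the induction without any uniqueness theorem. The upper end
  \<open>b\<close> gives one bound on \<open>h\<close> for all heights.\<close>

lemma continuous_on_tonelli_start:
  assumes "0 \<le> \<delta>" "r \<in> {0..1}"
  shows "continuous_on {a..b} (\<lambda>d. tonelli N h \<delta> d k r)"
  using assms(2)
proof (induction k arbitrary: r)
  case 0
  then show ?case by (auto intro: continuous_intros)
next
  case (Suc k)
  obtain M where M: "\<And>s. s \<le> b \<Longrightarrow> h s \<le> M" using h_bounded_above[of b] by blast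
  show ?case
    unfolding continuous_on_sequentially
  proof (intro allI ballI impI)
    fix x e assume e: "e \<in> {a..b}" and x: "(\<forall>n. x n \<in> {a..b}) \<and> x \<longlonglongrightarrow> e"
    have "(\<lambda>n. shoot N h (x n) (\<lambda>s. tonelli N h \<delta> (x n) k (max 0 (s - \<delta>))) r)
        \<longlonglongrightarrow> shoot N h e (\<lambda>s. tonelli N h \<delta> e k (max 0 (s - \<delta>))) r"
    proof (rule shoot_tendsto[where M = M])
      fix s :: real assume "s \<in> {0..1}"
      then have s: "max 0 (s - \<delta>) \<in> {0..1}" using assms(1) by auto
      show "(\<lambda>n. tonelli N h \<delta> (x n) k (max 0 (s - \<delta>))) \<longlonglongrightarrow> tonelli N h \<delta> e k (max 0 (s - \<delta>))"
        using Suc.IH[OF s] x e unfolding continuous_on_sequentially comp_def by blast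
      show "h (tonelli N h \<delta> (x n) k (max 0 (s - \<delta>))) \<le> M" for n
        using tonelli_le[OF assms(1) s, of "x n" k] x by (intro M) (auto intro: order_trans)
    qed (use x Suc.prems in \<open>auto intro!: continuous_on_delay continuous_on_tonelli assms(1)\<close>)
    then show "((\<lambda>d. tonelli N h \<delta> d (Suc k) r) \<circ> x) \<longlonglongrightarrow> tonelli N h \<delta> e (Suc k) r"
      by (simp add: comp_def)
  qed
qed

lemma continuous_on_approximant: "continuous_on {0..1} (approximant N h n d)"
  unfolding approximant_def by (rule continuous_on_tonelli) simp

lemma continuous_on_approximant_start:
  "r \<in> {0..1} \<Longrightarrow> continuous_on {a..b} (\<lambda>d. approximant N h n d r)"
  unfolding approximant_def by (rule continuous_on_tonelli_start) simp

lemma approximant_le: "r \<in> {0..1} \<Longrightarrow> approximant N h n d r \<le> d"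
  unfolding approximant_def by (rule tonelli_le) simp

lemma continuous_on_delayed_approximant:
  "continuous_on {0..1} (\<lambda>s. approximant N h n d (max 0 (s - 1 / real (Suc n))))"
  by (intro continuous_on_delay continuous_on_approximant) simp

text \<open>One further iteration changes nothing on \<open>{0..1}\<close>; unfolding it shows that
  the approximant solves the delayed equation there.\<close>

lemma approximant_eq:
  assumes "r \<in> {0..1}"
  shows "approximant N h n d r =
    shoot N h d (\<lambda>s. approximant N h n d (max 0 (s - 1 / real (Suc n)))) r"
  using tonelli_stable[of "1 / real (Suc n)" r "Suc n" d] assms
  by (simp add: approximant_def del: tonelli.simps) (simp only: tonelli.simps)

lemma shoot_lipschitz:
  assumes y: "continuous_on {0..1} y" and M: "\<And>s. s \<in> {0..1} \<Longrightarrow> h (y s) \<le> M" and "0 \<le> M"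
    and st: "s \<in> {0..1}" "t \<in> {0..1}"
  shows "\<bar>shoot N h d y s - shoot N h d y t\<bar> \<le> root N M * \<bar>s - t\<bar>"
proof -
  have *: "\<bar>shoot N h d y a - shoot N h d y b\<bar> \<le> root N M * \<bar>a - b\<bar>"
    if ab: "0 \<le> a" "a \<le> b" "b \<le> 1" for a b
  proof -
    have "slope N h y b \<le> root N M * b"
      using ab by (intro slope_upper y M) auto
    also have "\<dots> \<le> root N M"
      using ab \<open>0 \<le> M\<close> by (simp add: mult_left_le real_root_ge_zero)
    finally have "(b - a) * slope N h y b \<le> (b - a) * root N M"
      using ab by (intro mult_left_mono) auto
    then show ?thesis
      using shoot_drop_upper[OF y ab, of d] shoot_antimono[OF y ab, of d] ab
      by (simp add: mult.commute)
  qed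
  show ?thesis
    using *[of s t] *[of t s] st by (cases "s \<le> t") (auto simp: abs_minus_commute)
qed

text \<open>One bound on \<open>h\<close> gives a common Lipschitz constant, hence equicontinuity.
  The heights may vary with \<open>n\<close>, as the shooting argument selects a different one for
  each delay; strict monotonicity of \<open>\<sigma>\<close> sends the delay to 0.\<close>

lemma approximants_compact:
  assumes "strict_mono \<sigma>" and d: "\<And>n. d n \<in> {a..b}"
  obtains \<nu> e w where "strict_mono (\<nu> :: nat \<Rightarrow> nat)" "e \<in> {a..b}" "continuous_on {0..1} w"
    "\<And>r. r \<in> {0..1} \<Longrightarrow> (\<lambda>n. approximant N h (\<sigma> (\<nu> n)) (d (\<nu> n)) r) \<longlonglongrightarrow> w r"
    "\<And>r. r \<in> {0..1} \<Longrightarrow> w r = shoot N h e w r"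
proof -
  obtain M where M: "0 \<le> M" "\<And>s. s \<le> b \<Longrightarrow> h s \<le> M" using h_bounded_above[of b] by blast
  define L where "L = root N M"
  have L: "0 \<le> L" using M by (simp add: L_def real_root_ge_zero)
  define W where "W n = approximant N h (\<sigma> n) (d n)" for n
  define Y where "Y n s = W n (max 0 (s - 1 / real (Suc (\<sigma> n))))" for n s
  have Y: "continuous_on {0..1} (Y n)" for n
    unfolding Y_def W_def by (rule continuous_on_delayed_approximant)
  have W_le: "W n r \<le> b" if "r \<in> {0..1}" for n r
    using approximant_le[OF that, of "\<sigma> n" "d n"] d[of n] by (auto simp: W_def)
  have delay_mem: "max 0 (s - 1 / real (Suc n)) \<in> {0..1}" if "s \<in> {0..1}" for s n
    using that by (auto intro: order_trans[of _ s])
  have hY: "h (Y n s) \<le> M" if "s \<in> {0..1}" for n s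
    unfolding Y_def by (intro M W_le delay_mem that)
  have W_eq: "W n r = shoot N h (d n) (Y n) r" if "r \<in> {0..1}" for n r
    unfolding W_def Y_def[abs_def] by (rule approximant_eq[OF that])
  have lip: "\<bar>W n s - W n t\<bar> \<le> L * \<bar>s - t\<bar>" if "s \<in> {0..1}" "t \<in> {0..1}" for n s t
    unfolding L_def using shoot_lipschitz[OF Y hY M(1) that] that by (simp add: W_eq)
  have bounded: "norm (W n r) \<le> (\<bar>a\<bar> + \<bar>b\<bar>) + L" if r: "r \<in> {0..1}" for n r
  proof -
    have "\<bar>W n r - W n 0\<bar> \<le> L * \<bar>r - 0\<bar>" using r by (intro lip) auto
    also have "\<dots> \<le> L" using r L by (simp add: mult_left_le)
    finally have "\<bar>W n r - d n\<bar> \<le> L" by (simp add: W_eq)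
    then show ?thesis using d[of n] by auto
  qed
  obtain w k where w: "continuous_on {0..1} w" and k: "strict_mono (k :: nat \<Rightarrow> nat)"
    and conv: "\<And>e. 0 < e \<Longrightarrow> \<exists>n0. \<forall>n x. n0 \<le> n \<and> x \<in> {0..1} \<longrightarrow> norm (W (k n) x - w x) < e"
  proof (rule Arzela_Ascoli[OF compact_Icc[of 0 1], where \<F> = W])
    show "norm (W n x) \<le> (\<bar>a\<bar> + \<bar>b\<bar>) + L" if "x \<in> {0..1}" for n x using that by (rule bounded)
    show "\<exists>d>0. \<forall>n y. y \<in> {0..1} \<and> norm (x - y) < d \<longrightarrow> norm (W n x - W n y) < e"
      if "x \<in> {0..1}" "0 < e" for x e
    \<comment> \<open>\<open>L + 1\<close> instead of \<open>L\<close>, since the Lipschitz constant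
      may be 0.\<close>
    proof (intro exI[of _ "e / (L + 1)"] conjI allI impI)
      fix n y assume y: "y \<in> {0..1} \<and> norm (x - y) < e / (L + 1)"
      have "norm (W n x - W n y) \<le> L * \<bar>x - y\<bar>" using lip[OF that(1), of y n] y by simp
      also have "\<dots> \<le> (L + 1) * \<bar>x - y\<bar>" by (intro mult_right_mono) auto
      also have "\<dots> < e" using y L by (simp add: pos_less_divide_eq mult.commute)
      finally show "norm (W n x - W n y) < e" .
    qed (use that L in auto)
  qed auto
  have "seq_compact {a..b}" using compact_Icc by (rule compact_imp_seq_compact)
  then obtain e j where e: "e \<in> {a..b}" and j: "strict_mono (j :: nat \<Rightarrow> nat)"
    and de: "((d \<circ> k) \<circ> j) \<longlonglongrightarrow> e"
    using d unfolding seq_compact_def by (metis comp_apply)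
  define \<nu> where "\<nu> = k \<circ> j"
  have \<nu>: "strict_mono \<nu>" unfolding \<nu>_def using k j by (rule strict_mono_o)
  have Wlim: "(\<lambda>n. W (\<nu> n) r) \<longlonglongrightarrow> w r" if r: "r \<in> {0..1}" for r
  proof -
    have "(\<lambda>n. W (k n) r) \<longlonglongrightarrow> w r"
      unfolding LIMSEQ_iff using conv r by blast
    from LIMSEQ_subseq_LIMSEQ[OF this j] show ?thesis by (simp add: \<nu>_def comp_def)
  qed
  have delay: "(\<lambda>n. 1 / real (Suc (\<sigma> (\<nu> n)))) \<longlonglongrightarrow> 0"
    using LIMSEQ_subseq_LIMSEQ[OF LIMSEQ_inverse_real_of_nat strict_mono_o[OF assms(1) \<nu>]]
    by (simp add: comp_def inverse_eq_divide)
  \<comment> \<open>The delay moves the argument by at most its own length, which changes the value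
    by at most \<open>L\<close> times that; delayed and undelayed functions share their
    limit.\<close>
  have Ylim: "(\<lambda>n. Y (\<nu> n) s) \<longlonglongrightarrow> w s" if s: "s \<in> {0..1}" for s
  proof -
    have "(\<lambda>n. Y (\<nu> n) s - W (\<nu> n) s) \<longlonglongrightarrow> 0"
    proof (rule Lim_null_comparison)
      show "\<forall>\<^sub>F n in sequentially. norm (Y (\<nu> n) s - W (\<nu> n) s) \<le> L * (1 / real (Suc (\<sigma> (\<nu> n))))"
      proof (intro always_eventually allI)
        fix n
        have "norm (Y (\<nu> n) s - W (\<nu> n) s) \<le> L * \<bar>max 0 (s - 1 / real (Suc (\<sigma> (\<nu> n)))) - s\<bar>"
          unfolding Y_def real_norm_def by (intro lip delay_mem s)
        also have "\<dots> \<le> L * (1 / real (Suc (\<sigma> (\<nu> n))))"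
          using L s by (intro mult_left_mono) auto
        finally show "norm (Y (\<nu> n) s - W (\<nu> n) s) \<le> L * (1 / real (Suc (\<sigma> (\<nu> n))))" .
      qed
      show "(\<lambda>n. L * (1 / real (Suc (\<sigma> (\<nu> n))))) \<longlonglongrightarrow> 0"
        using tendsto_mult_right_zero[OF delay] by blast
    qed
    from tendsto_add[OF this Wlim[OF s]] show ?thesis by simp
  qed
  have "w r = shoot N h e w r" if r: "r \<in> {0..1}" for r
  proof (rule LIMSEQ_unique[OF Wlim[OF r]])
    have "(\<lambda>n. shoot N h (d (\<nu> n)) (Y (\<nu> n)) r) \<longlonglongrightarrow> shoot N h e w r"
      using de by (intro shoot_tendsto[OF Y w Ylim hY _ r]) (auto simp: \<nu>_def comp_def)
    then show "(\<lambda>n. W (\<nu> n) r) \<longlonglongrightarrow> shoot N h e w r"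
      by (simp add: W_eq[OF r])
  qed
  then show ?thesis
    using that[OF \<nu> e w] Wlim by (simp add: W_def)
qed

end

section \<open>Regularity of solutions\<close>

context radial
begin

lemma flux_strict_mono:
  assumes y: "continuous_on {0..1} y" and st: "0 \<le> s" "s < t" "t \<le> 1"
    and pos: "\<And>x. s < x \<Longrightarrow> x < t \<Longrightarrow> 0 < h (y x)"
  shows "flux N h y s < flux N h y t"
proof (rule DERIV_pos_imp_increasing_open[OF \<open>s < t\<close>])
  show "\<exists>D. (flux N h y has_real_derivative D) (at x) \<and> 0 < D" if "s < x" "x < t" for x
    using flux_has_derivative[OF y, of x] that st pos[OF that] N_pos
    by (intro exI[of _ "real N * x ^ (N - 1) * h (y x)"]) (auto simp: at_within_Icc_at)
  show "continuous_on {s..t} (flux N h y)"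
    using st by (intro continuous_on_subset[OF continuous_on_flux[OF y]]) auto
qed

end

text \<open>No condition is imposed at 1: the sign of \<open>w 1\<close> is what the shooting and
  the construction of the eigenvalue examine.\<close>

locale profile = forcing +
  fixes w :: "real \<Rightarrow> real" and e :: real
  assumes w_cont: "continuous_on {0..1} w"
    and w_eq: "r \<in> {0..1} \<Longrightarrow> w r = shoot N h e w r"
    and e_pos: "0 < e"
begin

lemma w_0: "w 0 = e"
  using w_eq[of 0] by simp

lemma w_has_derivative:
  assumes "t \<in> {0..1}"
  shows "(w has_real_derivative - slope N h w t) (at t within {0..1})"
  by (rule has_field_derivative_transform_within[OF shoot_has_derivative[OF w_cont assms, of e]
        zero_less_one assms])
     (simp add: w_eq)

text \<open>By continuity \<open>w\<close> is positive near 0, so the flux becomes positive at once;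
  it never decreases afterwards, even where \<open>w\<close> is negative.\<close>

lemma flux_pos:
  assumes "0 < t" "t \<le> 1"
  shows "0 < flux N h w t"
proof -
  have "\<forall>\<^sub>F s in at 0 within {0..1}. 0 < w s"
    using w_cont e_pos w_0 by (intro order_tendstoD(1)[where y = e]) (auto simp: continuous_on_def)
  then obtain d where d: "0 < d" "\<And>s. s \<in> {0..1} \<Longrightarrow> s \<noteq> 0 \<Longrightarrow> dist s 0 < d \<Longrightarrow> 0 < w s"
    by (auto simp: eventually_at)
  have "flux N h w 0 < flux N h w (min d t)"
    using assms d by (intro flux_strict_mono w_cont h_pos) auto
  also have "\<dots> \<le> flux N h w t"
    using assms d by (intro flux_mono w_cont) auto
  finally show ?thesis by simp
qed

lemma slope_pos:
  assumes "0 < t" "t \<le> 1"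
  shows "0 < slope N h w t"
  using flux_pos[OF assms] N_pos by (simp add: slope_def real_root_gt_zero)

lemma w_strict_antimono:
  assumes "0 \<le> s" "s < t" "t \<le> 1"
  shows "w t < w s"
proof (rule DERIV_neg_imp_decreasing_open[OF \<open>s < t\<close>])
  show "\<exists>D. (w has_real_derivative D) (at x) \<and> D < 0" if "s < x" "x < t" for x
    using w_has_derivative[of x] slope_pos[of x] that assms
    by (intro exI[of _ "- slope N h w x"]) (auto simp: at_within_Icc_at)
  show "continuous_on {s..t} w"
    using assms by (intro continuous_on_subset[OF w_cont]) auto
qed

text \<open>Near 0 the values \<open>h (w s)\<close> are close to \<open>h e\<close>, which squeezes
  the flux between multiples of \<open>t ^ N\<close>. The limit is the derivative of
  \<open>slope\<close> at 0, where the root is not differentiable and the chain rule fails for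
  \<open>N > 1\<close>.\<close>

lemma slope_quotient_tendsto:
  "((\<lambda>t. slope N h w t / t) \<longlongrightarrow> root N (h e)) (at 0 within {0..1})"
proof -
  have "((\<lambda>t. flux N h w t / t ^ N) \<longlongrightarrow> h e) (at 0 within {0..1})"
  proof (rule tendstoI)
    fix \<epsilon> :: real assume "0 < \<epsilon>"
    then have "0 < \<epsilon> / 2" by simp
    moreover have "((\<lambda>s. h (w s)) \<longlongrightarrow> h e) (at 0 within {0..1})"
      using continuous_on_h_comp[OF w_cont] w_0 by (auto simp: continuous_on_def)
    ultimately have "\<forall>\<^sub>F s in at 0 within {0..1}. dist (h (w s)) (h e) < \<epsilon> / 2"
      by (rule tendstoD[rotated])
    then obtain d where d: "0 < d"
      "\<And>s. s \<in> {0..1} \<Longrightarrow> s \<noteq> 0 \<Longrightarrow> dist s 0 < d \<Longrightarrow> dist (h (w s)) (h e) < \<epsilon> / 2"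
      by (auto simp: eventually_at)
    have "dist (flux N h w t / t ^ N) (h e) < \<epsilon>" if t: "t \<in> {0..1}" "t \<noteq> 0" "dist t 0 < d" for t
    proof -
      have "\<bar>h (w s) - h e\<bar> \<le> \<epsilon> / 2" if "s \<in> {0..t}" for s
        using d(2)[of s] that t w_0 \<open>0 < \<epsilon>\<close> by (cases "s = 0") (auto simp: dist_real_def)
      then have near: "h e - \<epsilon> / 2 \<le> h (w s)" "h (w s) \<le> h e + \<epsilon> / 2" if "s \<in> {0..t}" for s
        using that unfolding abs_diff_le_iff by blast+
      have "(h e - \<epsilon> / 2) * t ^ N \<le> flux N h w t" "flux N h w t \<le> (h e + \<epsilon> / 2) * t ^ N"
        by (rule flux_lower[OF w_cont t(1) near(1)], assumption,
            rule flux_upper[OF w_cont t(1) near(2)], assumption)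
      moreover have "0 < t ^ N" using t by auto
      ultimately have "h e - \<epsilon> / 2 \<le> flux N h w t / t ^ N" "flux N h w t / t ^ N \<le> h e + \<epsilon> / 2"
        by (auto simp: pos_le_divide_eq pos_divide_le_eq)
      then show ?thesis using \<open>0 < \<epsilon>\<close> by (auto simp: dist_real_def abs_less_iff)
    qed
    then show "\<forall>\<^sub>F t in at 0 within {0..1}. dist (flux N h w t / t ^ N) (h e) < \<epsilon>"
      using d(1) unfolding eventually_at by auto
  qed
  then have "((\<lambda>t. root N (flux N h w t / t ^ N)) \<longlongrightarrow> root N (h e)) (at 0 within {0..1})"
    by (intro tendsto_intros)
  moreover have "\<forall>\<^sub>F t in at 0 within {0..1}. root N (flux N h w t / t ^ N) = slope N h w t / t"
    unfolding eventually_at using N_pos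
    by (intro exI[of _ 1]) (auto simp: slope_def real_root_divide real_root_power_cancel)
  ultimately show ?thesis
    by (rule Lim_transform_eventually)
qed

text \<open>The derivative is written through the quotient \<open>t / slope\<close>, because that
  quotient has a positive limit at 0.\<close>

lemma slope_has_derivative:
  assumes "0 < t" "t \<le> 1"
  shows "(slope N h w has_real_derivative (t / slope N h w t) ^ (N - 1) * h (w t))
           (at t within {0..1})"
proof -
  have "(slope N h w has_real_derivative
      inverse (real N * root N (flux N h w t) ^ (N - Suc 0)) * (real N * t ^ (N - 1) * h (w t)))
      (at t within {0..1})"
    unfolding slope_def[abs_def]
    using assms
    by (intro DERIV_chain2[where f = "root N" and g = "flux N h w"]
        DERIV_real_root[OF N_pos flux_pos[OF assms]] flux_has_derivative[OF w_cont]) auto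
  then show ?thesis
    by (rule DERIV_cong)
       (use N_pos slope_pos[OF assms] in \<open>simp add: slope_def[symmetric] field_simps power_divide\<close>)
qed

text \<open>Only the origin is delicate. The quotient \<open>slope / t\<close>, extended by
  \<open>R\<close> at 0, is continuous and positive, so \<open>q\<close> is continuous;
  \<open>R ^ N = h e\<close> makes \<open>q 0\<close> equal to the derivative \<open>R\<close> found
  there.\<close>

lemma C2_profile: "C2_with_deriv w (\<lambda>t. - slope N h w t)"
proof -
  define R where "R = root N (h e)"
  have R: "0 < R" "R ^ N = h e"
    using h_pos[OF e_pos] N_pos by (auto simp: R_def real_root_gt_zero)
  define \<rho> where "\<rho> t = (if t = 0 then R else slope N h w t / t)" for t
  define q where "q t = inverse (\<rho> t) ^ (N - 1) * h (w t)" for t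
  have \<rho>_pos: "0 < \<rho> t" if "t \<in> {0..1}" for t
    using that R slope_pos[of t] by (auto simp: \<rho>_def)
  have \<rho>_cont: "continuous_on {0..1} \<rho>"
    unfolding continuous_on_def
  proof
    fix t :: real assume t: "t \<in> {0..1}"
    show "(\<rho> \<longlongrightarrow> \<rho> t) (at t within {0..1})"
    proof (cases "t = 0")
      case True
      have "\<forall>\<^sub>F s in at 0 within {0..1}. slope N h w s / s = \<rho> s"
        by (auto simp: eventually_at \<rho>_def intro!: exI[of _ 1])
      from Lim_transform_eventually[OF slope_quotient_tendsto this] show ?thesis
        unfolding True by (simp add: \<rho>_def[of 0] R_def)
    next
      case False
      have "continuous_on {0<..1} (\<lambda>s. slope N h w s / s)"
        by (intro continuous_intros continuous_on_subset[OF continuous_on_slope[OF w_cont]]) auto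
      then have "continuous_on {0<..1} \<rho>"
        by (rule continuous_on_eq) (auto simp: \<rho>_def)
      then have "(\<rho> \<longlongrightarrow> \<rho> t) (at t within {0<..1})"
        using t False by (auto simp: continuous_on_def)
      moreover have "at t within {0..1} = at t within {0<..1}"
        using t False by (intro at_within_nhd[of _ "{0<..}"]) auto
      ultimately show ?thesis by simp
    qed
  qed
  have q_cont: "continuous_on {0..1} q"
    unfolding q_def[abs_def] using \<rho>_pos
    by (intro continuous_intros \<rho>_cont continuous_on_h_comp w_cont) force
  have "(slope N h w has_real_derivative q t) (at t within {0..1})" if t: "t \<in> {0..1}" for t
  proof (cases "t = 0")
    case True
    have "h e = R ^ (N - 1) * R"
      using power_minus_mult[OF N_pos, of R] R by simp
    then have "q 0 = R"
      using R(1) by (simp add: q_def \<rho>_def w_0 power_inverse)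
    then show ?thesis
      using slope_quotient_tendsto by (simp add: has_field_derivative_iff True R_def)
  next
    case False
    then show ?thesis
      using slope_has_derivative[of t] t by (simp add: q_def \<rho>_def)
  qed
  then show ?thesis
    unfolding C2_with_deriv_def
    by (intro exI[of _ "\<lambda>t. - q t"] conjI ballI continuous_intros q_cont
        continuous_on_slope w_cont w_has_derivative DERIV_minus) auto
qed

end

section \<open>Comparison for the eigenvalue problem\<close>

text \<open>A weighted \<open>L^N\<close> norm of the positive part of \<open>y\<close> on
  \<open>{0..t}\<close>, hence monotone and positively homogeneous of degree 1. It is the slope in
  the eigenvalue problem with parameter 1.\<close>

definition wnorm :: "nat \<Rightarrow> (real \<Rightarrow> real) \<Rightarrow> real \<Rightarrow> real" where
  "wnorm N y = slope N (\<lambda>s. max 0 s ^ N) y"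

lemma radial_power: "N \<ge> 1 \<Longrightarrow> radial N (\<lambda>s. max 0 s ^ N)"
  by unfold_locales (auto intro!: continuous_intros)

lemma forcing_power:
  assumes "N \<ge> 1" "0 < c"
  shows "forcing N (\<lambda>s. (c * max 0 s) ^ N)"
  using assms by unfold_locales (auto intro!: continuous_intros simp: max.absorb1 max.absorb2)

lemma wnorm_mono:
  assumes "N \<ge> 1" "continuous_on {0..1} v" "continuous_on {0..1} w" "0 \<le> c"
    and le: "\<And>s. s \<in> {0..1} \<Longrightarrow> c * v s \<le> w s" and t: "t \<in> {0..1}"
  shows "c * wnorm N v t \<le> wnorm N w t"
proof -
  interpret radial N "\<lambda>s. max 0 s ^ N" using assms(1) by (rule radial_power)
  have "c ^ N * flux N (\<lambda>s. max 0 s ^ N) v t \<le> flux N (\<lambda>s. max 0 s ^ N) w t"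
  proof (rule has_integral_le[OF has_integral_mult_right[OF flux_has_integral[OF assms(2) t]]
        flux_has_integral[OF assms(3) t]])
    fix s assume s: "s \<in> {0..t}"
    have "c * max 0 (v s) \<le> max 0 (w s)"
      using le[of s] s t \<open>0 \<le> c\<close> by (auto simp: max_def mult_nonneg_nonpos)
    then have "(c * max 0 (v s)) ^ N \<le> max 0 (w s) ^ N"
      using \<open>0 \<le> c\<close> by (intro power_mono) auto
    then have "real N * s ^ (N - 1) * (c * max 0 (v s)) ^ N \<le> real N * s ^ (N - 1) * max 0 (w s) ^ N"
      using s by (intro mult_left_mono) auto
    then show "c ^ N * (real N * s ^ (N - 1) * max 0 (v s) ^ N) \<le> real N * s ^ (N - 1) * max 0 (w s) ^ N"
      by (simp add: power_mult_distrib mult_ac)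
  qed
  then have "root N (c ^ N * flux N (\<lambda>s. max 0 s ^ N) v t) \<le> wnorm N w t"
    using N_pos by (simp add: wnorm_def slope_def)
  then show ?thesis
    using N_pos \<open>0 \<le> c\<close> by (simp add: wnorm_def slope_def real_root_mult real_root_power_cancel)
qed

text \<open>As \<open>y\<close> may vanish at 1, its minimum is taken over \<open>{0..1/2}\<close>
  only; monotonicity carries the bound to the rest of the interval at the cost of a factor
  2.\<close>

lemma wnorm_linear_lower:
  assumes "N \<ge> 1" and y: "continuous_on {0..1} y" and pos: "\<And>s. s \<in> {0..<1} \<Longrightarrow> 0 < y s"
  obtains m where "0 < m" "\<And>t. t \<in> {0..1} \<Longrightarrow> m * t \<le> wnorm N y t"
proof -
  interpret radial N "\<lambda>s. max 0 s ^ N" using assms(1) by (rule radial_power)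
  have "continuous_on {0..1/2} y" by (rule continuous_on_subset[OF y]) auto
  then obtain x where x: "x \<in> {0..1/2}" "\<And>s. s \<in> {0..1/2} \<Longrightarrow> y x \<le> y s"
    using continuous_attains_inf[of "{0..1/2::real}" y] by auto
  have m: "0 < y x" using x by (intro pos) auto
  have low: "y x * t \<le> wnorm N y t" if "t \<in> {0..1/2}" for t
  proof -
    have "root N (y x ^ N) * t \<le> slope N (\<lambda>s. max 0 s ^ N) y t"
      using that x(2) m by (intro slope_lower y power_mono) (auto intro: max.coboundedI2)
    then show ?thesis using m N_pos by (simp add: wnorm_def real_root_power_cancel)
  qed
  show ?thesis
  proof (rule that[of "y x / 2"])
    fix t :: real assume t: "t \<in> {0..1}"
    show "y x / 2 * t \<le> wnorm N y t"
    proof (cases "t \<le> 1/2")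
      case True
      then have "y x * t \<le> wnorm N y t" using t by (intro low) auto
      moreover have "0 \<le> y x * t" using t m by simp
      ultimately show ?thesis by simp
    next
      case False
      have "y x / 2 * t \<le> y x * (1/2)" using t m by simp
      also have "\<dots> \<le> wnorm N y (1/2)" by (rule low) simp
      also have "\<dots> \<le> wnorm N y t"
        unfolding wnorm_def using False t by (intro slope_mono y) auto
      finally show ?thesis .
    qed
  qed (use m in simp)
qed

lemma wnorm_integrable:
  assumes "N \<ge> 1" "continuous_on {0..1} y" "0 \<le> a" "b \<le> 1"
  shows "wnorm N y integrable_on {a..b}"
  unfolding wnorm_def using assms by (intro radial.slope_integrable radial_power)

text \<open>The operator \<open>y \<mapsto> \<lambda>r. integral {r..1} (wnorm N y)\<close> is monotone and positively homogeneous, so a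
  lower bound \<open>c * v \<le> w\<close> improves itself by the factor \<open>\<kappa> / \<mu>\<close>.\<close>

lemma eigenvalue_comparison:
  assumes N: "N \<ge> 1" and v: "continuous_on {0..1} v" and w: "continuous_on {0..1} w"
    and v_pos: "\<And>r. r \<in> {0..<1} \<Longrightarrow> 0 < v r" and w_pos: "\<And>r. r \<in> {0..<1} \<Longrightarrow> 0 < w r"
    and v_sub: "\<And>r. r \<in> {0..1} \<Longrightarrow> v r \<le> \<mu> * integral {r..1} (wnorm N v)"
    and w_super: "\<And>r. r \<in> {0..1} \<Longrightarrow> \<kappa> * integral {r..1} (wnorm N w) \<le> w r"
    and "0 < \<mu>"
  shows "\<kappa> \<le> \<mu>"
proof (rule ccontr)
  assume "\<not> \<kappa> \<le> \<mu>"
  interpret radial N "\<lambda>s. max 0 s ^ N" using N by (rule radial_power)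
  obtain mv where mv: "0 < mv" "\<And>t. t \<in> {0..1} \<Longrightarrow> mv * t \<le> wnorm N v t"
    using wnorm_linear_lower[OF N v v_pos] by blast
  obtain mw where mw: "0 < mw" "\<And>t. t \<in> {0..1} \<Longrightarrow> mw * t \<le> wnorm N w t"
    using wnorm_linear_lower[OF N w w_pos] by blast
  have "bounded (v ` {0..1})"
    using v by (intro compact_imp_bounded compact_continuous_image) auto
  then obtain V where V: "0 < V" "\<And>s. s \<in> {0..1} \<Longrightarrow> \<bar>v s\<bar> \<le> V"
    by (auto simp: bounded_pos)
  have upper: "wnorm N v t \<le> V * t" if "t \<in> {0..1}" for t
  proof -
    have "slope N (\<lambda>s. max 0 s ^ N) v t \<le> root N (V ^ N) * t"
      using that V by (intro slope_upper v power_mono) (auto simp: abs_le_iff)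
    then show ?thesis using V N_pos by (simp add: wnorm_def real_root_power_cancel)
  qed
  \<comment> \<open>The start \<open>mw / V\<close> compares the lower bound \<open>mw * t\<close>
    for \<open>w\<close> with the upper bound \<open>V * t\<close> for \<open>v\<close>.\<close>
  define c where "c k = mw / V * (\<kappa> / \<mu>) ^ k" for k
  have c_nonneg: "0 \<le> c k" for k
    using mw V \<open>0 < \<mu>\<close> \<open>\<not> \<kappa> \<le> \<mu>\<close> by (simp add: c_def)
  \<comment> \<open>The induction compares the norms and not \<open>v\<close> and \<open>w\<close>
    themselves: both norms are comparable to \<open>t\<close>, whereas both functions may vanish at
    1.\<close>
  have "c k * wnorm N v t \<le> wnorm N w t" if "t \<in> {0..1}" for t k
    using that
  proof (induction k arbitrary: t)
    case 0
    have "mw / V * wnorm N v t \<le> mw / V * (V * t)"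
      using upper[OF 0] mw V by (intro mult_left_mono) auto
    also have "\<dots> \<le> wnorm N w t" using mw(2)[OF 0] V by simp
    finally show ?case by (simp add: c_def)
  next
    case (Suc k)
    show ?case
    proof (rule wnorm_mono[OF N v w c_nonneg _ Suc.prems])
      fix s :: real assume s: "s \<in> {0..1}"
      have "c (Suc k) * v s \<le> c (Suc k) * (\<mu> * integral {s..1} (wnorm N v))"
        using v_sub[OF s] c_nonneg by (rule mult_left_mono)
      also have "\<dots> = \<kappa> * integral {s..1} (\<lambda>t. c k * wnorm N v t)"
        using \<open>0 < \<mu>\<close> by (simp add: c_def)
      also have "\<dots> \<le> \<kappa> * integral {s..1} (wnorm N w)"
        using s \<open>0 < \<mu>\<close> \<open>\<not> \<kappa> \<le> \<mu>\<close> Suc.IH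
        by (intro mult_left_mono integral_le integrable_on_mult_right wnorm_integrable N v w) auto
      also have "\<dots> \<le> w s" by (rule w_super[OF s])
      finally show "c (Suc k) * v s \<le> w s" .
    qed
  qed
  note bound = this
  \<comment> \<open>At \<open>t = 1\<close> both norms are fixed positive numbers, while
    \<open>c k\<close> grows without bound.\<close>
  have "1 < \<kappa> / \<mu>" using \<open>0 < \<mu>\<close> \<open>\<not> \<kappa> \<le> \<mu>\<close> by simp
  then obtain k where k: "wnorm N w 1 / (mw / V * mv) < (\<kappa> / \<mu>) ^ k"
    using real_arch_pow by blast
  then have "wnorm N w 1 < (\<kappa> / \<mu>) ^ k * (mw / V * mv)"
    using mw V mv by (subst (asm) pos_divide_less_eq) auto
  also have "\<dots> = c k * mv" by (simp add: c_def)
  also have "\<dots> \<le> c k * wnorm N v 1"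
    using mv(2)[of 1] c_nonneg by (intro mult_left_mono) auto
  also have "\<dots> \<le> wnorm N w 1" by (rule bound) simp
  finally show False by simp
qed

section \<open>The first eigenvalue\<close>

text \<open>The equation is integrated twice. Between the integrations an \<open>N\<close>-th root
  is taken, which requires \<open>v' \<le> 0\<close>.\<close>

lemma pos_eigenfunction_integral_eq:
  assumes N: "N \<ge> 1" and "0 < \<mu>" and eig: "has_pos_eigenfunction N \<mu>"
  obtains v where "continuous_on {0..1} v" "\<And>r. r \<in> {0..<1} \<Longrightarrow> 0 < v r"
    "\<And>r. r \<in> {0..1} \<Longrightarrow> v r = \<mu> * integral {r..1} (wnorm N v)"
proof -
  interpret radial N "\<lambda>s. max 0 s ^ N" using N by (rule radial_power)
  obtain v v' where C2: "C2_with_deriv v v'"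
    and ode: "\<And>r. r \<in> {0<..<1} \<Longrightarrow> ((\<lambda>t. (- v' t) ^ N) has_real_derivative
              \<mu> ^ N * real N * r ^ (N - 1) * (v r) ^ N) (at r)"
    and bc: "v' 0 = 0" "v 1 = 0" and v_pos: "\<And>r. r \<in> {0<..<1} \<Longrightarrow> 0 < v r"
    using eig unfolding has_pos_eigenfunction_def by blast
  have v'_cont: "continuous_on {0..1} v'"
    and dv: "\<And>r. r \<in> {0..1} \<Longrightarrow> (v has_real_derivative v' r) (at r within {0..1})"
    using C2 unfolding C2_with_deriv_def by blast+
  have v_cont: "continuous_on {0..1} v" by (rule DERIV_continuous_on[OF dv])
  have v_nonneg: "0 \<le> v r" if "r \<in> {0..1}" for r
    using continuous_ge_on_closure[of "{0<..<1}" v r 0] v_cont v_pos that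
    by (auto intro: less_imp_le)
  let ?F = "flux N (\<lambda>s. max 0 s ^ N) v"
  have v'_power: "(- v' t) ^ N = \<mu> ^ N * ?F t" if t: "t \<in> {0..1}" for t
  proof -
    have "((\<lambda>r. \<mu> ^ N * real N * r ^ (N - 1) * (v r) ^ N) has_integral
        (- v' t) ^ N - (- v' 0) ^ N) {0..t}"
      using t ode
      by (intro fundamental_theorem_of_calculus_interior continuous_intros
          continuous_on_subset[OF v'_cont])
         (auto simp flip: has_real_derivative_iff_has_vector_derivative)
    then have "((\<lambda>r. \<mu> ^ N * real N * r ^ (N - 1) * (v r) ^ N) has_integral (- v' t) ^ N) {0..t}"
      using bc N by (simp add: power_0_left)
    moreover have "((\<lambda>r. \<mu> ^ N * (real N * r ^ (N - 1) * max 0 (v r) ^ N)) has_integral \<mu> ^ N * ?F t) {0..t}"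
      by (intro has_integral_mult_right flux_has_integral v_cont t)
    then have "((\<lambda>r. \<mu> ^ N * real N * r ^ (N - 1) * (v r) ^ N) has_integral \<mu> ^ N * ?F t) {0..t}"
      by (rule has_integral_eq[rotated]) (use t v_nonneg in \<open>auto simp: max.absorb2\<close>)
    ultimately show ?thesis by (rule has_integral_unique)
  qed
  have F_pos: "0 < ?F t" if "0 < t" "t \<le> 1" for t
    using flux_strict_mono[OF v_cont, of 0 t] that v_pos by auto
  have v'_nonzero: "v' t \<noteq> 0" if "t \<in> {0<..1}" for t
    using v'_power[of t] F_pos[of t] that \<open>0 < \<mu>\<close> N by (auto simp: power_0_left)
  \<comment> \<open>For even \<open>N\<close> the power does not show the sign of \<open>v'\<close>.
    Having no zero on the connected set \<open>{0<..1}\<close>, \<open>v'\<close> keeps one sign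
    there; a positive one would contradict \<open>0 < v (1/2)\<close> and
    \<open>v 1 = 0\<close>.\<close>
  have v'_neg: "v' t \<le> 0" if t: "t \<in> {0..1}" for t
  proof (rule ccontr)
    assume "\<not> v' t \<le> 0"
    then have "0 < v' t" "t \<in> {0<..1}" using t bc by (auto simp: less_eq_real_def)
    have conn: "connected (v' ` {0<..1})"
      by (intro connected_continuous_image continuous_on_subset[OF v'_cont]) auto
    have pos: "0 < v' s" if "s \<in> {0<..1}" for s
    proof (rule ccontr)
      assume "\<not> 0 < v' s"
      then have "0 \<in> v' ` {0<..1}"
        using connectedD_interval[OF conn, of "v' s" "v' t" 0] \<open>0 < v' t\<close> \<open>t \<in> {0<..1}\<close> that
        by simp
      then show False using v'_nonzero by force
    qed
    have "v (1/2) < v 1"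
    proof (rule DERIV_pos_imp_increasing_open[where f = v])
      show "\<exists>D. (v has_real_derivative D) (at x) \<and> 0 < D" if "1/2 < x" "x < 1" for x
        using dv[of x] pos[of x] that by (intro exI[of _ "v' x"]) (auto simp: at_within_Icc_at)
    qed (auto intro: continuous_on_subset[OF v_cont])
    then show False using bc v_pos[of "1/2"] by simp
  qed
  have v'_eq: "- v' t = \<mu> * wnorm N v t" if t: "t \<in> {0..1}" for t
  proof -
    have "- v' t = root N ((- v' t) ^ N)"
      using v'_neg[OF t] N_pos by (simp add: real_root_power_cancel)
    also have "\<dots> = \<mu> * wnorm N v t"
      using \<open>0 < \<mu>\<close> N_pos
      by (simp add: v'_power[OF t] real_root_mult real_root_power_cancel wnorm_def slope_def)
    finally show ?thesis .
  qed
  have v_eq: "v r = \<mu> * integral {r..1} (wnorm N v)" if r: "r \<in> {0..1}" for r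
  proof -
    have "(v' has_integral v 1 - v r) {r..1}"
    proof (rule fundamental_theorem_of_calculus)
      show "(v has_vector_derivative v' x) (at x within {r..1})" if "x \<in> {r..1}" for x
        using DERIV_subset[OF dv[of x], of "{r..1}"] that r
        by (auto simp flip: has_real_derivative_iff_has_vector_derivative)
    qed (use r in auto)
    from has_integral_neg[OF this] have "((\<lambda>t. - v' t) has_integral v r) {r..1}"
      using bc by simp
    then have "((\<lambda>t. \<mu> * wnorm N v t) has_integral v r) {r..1}"
      by (rule has_integral_eq[rotated]) (use r v'_eq in auto)
    then show ?thesis by (simp add: integral_unique flip: integral_mult_right)
  qed
  \<comment> \<open>Positivity is given only inside the interval; the integral form transfers it to
    0.\<close>
  have "v (1/2) \<le> v 0"
    unfolding v_eq[of "1/2", simplified] v_eq[of 0, simplified]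
    using \<open>0 < \<mu>\<close> slope_nonneg[OF v_cont]
    by (intro mult_left_mono integral_subset_le wnorm_integrable N v_cont) (auto simp: wnorm_def)
  then have "0 < v 0" using v_pos[of "1/2"] by simp
  then have "0 < v r" if "r \<in> {0..<1}" for r
    using v_pos[of r] that by (cases "r = 0") auto
  then show ?thesis using that v_cont v_eq by blast
qed

text \<open>Each eigenfunction is both a subsolution and a supersolution, so the comparison applies
  in both directions.\<close>

lemma pos_eigenvalue_unique:
  assumes "N \<ge> 1" "0 < \<mu>" "has_pos_eigenfunction N \<mu>" "0 < \<kappa>" "has_pos_eigenfunction N \<kappa>"
  shows "\<kappa> = \<mu>"
proof -
  obtain v where v: "continuous_on {0..1} v" "\<And>r. r \<in> {0..<1} \<Longrightarrow> 0 < v r"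
    "\<And>r. r \<in> {0..1} \<Longrightarrow> v r = \<mu> * integral {r..1} (wnorm N v)"
    using pos_eigenfunction_integral_eq[OF assms(1-3)] by blast
  obtain w where w: "continuous_on {0..1} w" "\<And>r. r \<in> {0..<1} \<Longrightarrow> 0 < w r"
    "\<And>r. r \<in> {0..1} \<Longrightarrow> w r = \<kappa> * integral {r..1} (wnorm N w)"
    using pos_eigenfunction_integral_eq[OF assms(1,4,5)] by blast
  have "\<kappa> \<le> \<mu>"
    by (rule eigenvalue_comparison[OF assms(1) v(1) w(1) v(2) w(2) _ _ \<open>0 < \<mu>\<close>])
       (simp_all flip: v(3) w(3))
  moreover have "\<mu> \<le> \<kappa>"
    by (rule eigenvalue_comparison[OF assms(1) w(1) v(1) w(2) v(2) _ _ \<open>0 < \<kappa>\<close>])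
       (simp_all flip: v(3) w(3))
  ultimately show ?thesis by simp
qed

lemma (in forcing) profile_exists:
  assumes "0 < e"
  obtains w where "profile N h w e"
proof -
  obtain \<nu> e' w where "strict_mono (\<nu> :: nat \<Rightarrow> nat)" "e' \<in> {e..e}" "continuous_on {0..1} w"
    "\<And>r. r \<in> {0..1} \<Longrightarrow> w r = shoot N h e' w r"
    \<comment> \<open>The degenerate interval \<open>{e..e}\<close> fixes the height of the
      limit.\<close>
    by (rule approximants_compact[OF strict_mono_id, of "\<lambda>_. e" e e]) auto
  then have "profile N h w e" using assms by unfold_locales auto
  then show ?thesis by (rule that)
qed

lemma DERIV_dilate:
  fixes g :: "real \<Rightarrow> real"
  assumes "0 \<le> R" "R \<le> 1"
    and "(g has_real_derivative g') (at (R * r) within {0..1})" "r \<in> {0..1}"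
  shows "((\<lambda>t. g (R * t)) has_real_derivative g' * R) (at r within {0..1})"
proof -
  have "(g has_real_derivative g') (at (R * r) within (\<lambda>t. R * t) ` {0..1})"
    using assms(3) by (rule DERIV_subset) (use assms in \<open>auto intro: mult_le_one\<close>)
  moreover have "((\<lambda>t. R * t) has_real_derivative R) (at r within {0..1})"
    by (auto intro!: derivative_eq_intros)
  ultimately have "(g \<circ> (\<lambda>t. R * t) has_real_derivative g' * R) (at r within {0..1})"
    by (rule DERIV_image_chain)
  then show ?thesis by (simp add: comp_def)
qed

text \<open>The equation is invariant under dilations: if the solution of the initial value problem with
  coefficient 4 first vanishes at \<open>R\<close>, dilating it to the unit interval gives the eigenvalue \<open>4 * R\<^sup>2\<close>.\<close>

lemma pos_eigenvalue_exists:
  assumes "N \<ge> 1"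
  obtains \<mu> where "0 < \<mu>" "has_pos_eigenfunction N \<mu>"
proof -
  define h :: "real \<Rightarrow> real" where "h s = (4 * max 0 s) ^ N" for s
  interpret forcing N h
    unfolding h_def[abs_def] using assms by (rule forcing_power) simp
  obtain w where "profile N h w 1" by (rule profile_exists[of 1]) auto
  then interpret profile N h w 1 .
  \<comment> \<open>The coefficient 4 suffices: if \<open>w 1\<close> were positive, the slope at
    1/2 would be at least \<open>2 * w (1/2)\<close>, and the drop over \<open>{1/2..1}\<close> at
    least \<open>w (1/2)\<close>.\<close>
  have "w 1 \<le> 0"
  proof (rule ccontr)
    assume "\<not> w 1 \<le> 0"
    have pos: "0 < w (1/2)" using w_strict_antimono[of "1/2" 1] \<open>\<not> w 1 \<le> 0\<close> by simp
    have "root N ((4 * w (1/2)) ^ N) * (1/2) \<le> slope N h w (1/2)"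
    proof (rule slope_lower[OF w_cont])
      fix s :: real assume "s \<in> {0..1/2}"
      then have "w (1/2) \<le> w s"
        using shoot_antimono[OF w_cont, of s "1/2" 1] by (simp flip: w_eq)
      then show "(4 * w (1/2)) ^ N \<le> h (w s)"
        unfolding h_def using pos by (intro power_mono) auto
    qed auto
    then have "2 * w (1/2) \<le> slope N h w (1/2)"
      using pos real_root_power_cancel[OF N_pos, of "4 * w (1/2)"] by simp
    then show False
      using shoot_drop_lower[OF w_cont, of "1/2" 1 1] \<open>\<not> w 1 \<le> 0\<close> by (simp flip: w_eq)
  qed
  then obtain R where R: "0 \<le> R" "R \<le> 1" "w R = 0"
    using IVT2'[of w 1 0 0] w_cont w_0 by auto
  have "0 < R" using R w_0 by (cases "R = 0") auto
  have mem: "R * r \<in> {0..1}" if "r \<in> {0..1}" for r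
    using R that by (auto intro: mult_le_one)
  note dilate = DERIV_dilate[OF R(1,2)]
  define v where "v r = w (R * r)" for r
  define v' where "v' r = - slope N h w (R * r) * R" for r
  obtain q where q: "continuous_on {0..1} q"
    "\<And>r. r \<in> {0..1} \<Longrightarrow> ((\<lambda>t. - slope N h w t) has_real_derivative q r) (at r within {0..1})"
    using C2_profile unfolding C2_with_deriv_def by blast
  have comp: "continuous_on {0..1} (\<lambda>r. g (R * r))" if "continuous_on {0..1} g" for g :: "real \<Rightarrow> real"
    by (rule continuous_on_compose2[OF that]) (use mem in \<open>auto intro!: continuous_intros\<close>)
  have "C2_with_deriv v v'"
    unfolding C2_with_deriv_def
  proof (intro exI[of _ "\<lambda>r. q (R * r) * R * R"] conjI ballI)
    show "continuous_on {0..1} v'"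
      unfolding v'_def[abs_def] by (intro continuous_intros comp continuous_on_slope w_cont)
    show "continuous_on {0..1} (\<lambda>r. q (R * r) * R * R)"
      by (intro continuous_intros comp q)
    fix r :: real assume r: "r \<in> {0..1}"
    show "(v has_real_derivative v' r) (at r within {0..1})"
      unfolding v_def[abs_def] v'_def by (intro dilate w_has_derivative mem r)
    show "(v' has_real_derivative q (R * r) * R * R) (at r within {0..1})"
      unfolding v'_def[abs_def] by (intro DERIV_cmult_right dilate[OF q(2)] mem r)
  qed
  moreover have "((\<lambda>t. (- v' t) ^ N) has_real_derivative
      (4 * R\<^sup>2) ^ N * real N * r ^ (N - 1) * (v r) ^ N) (at r)" if r: "r \<in> {0<..<1}" for r
  proof -
    have pos: "0 < v r"
      using w_strict_antimono[of "R * r" R] r R \<open>0 < R\<close> by (simp add: v_def)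
    have "((\<lambda>t. R ^ N * flux N h w (R * t)) has_real_derivative
        R ^ N * (real N * (R * r) ^ (N - 1) * h (w (R * r)) * R)) (at r within {0..1})"
      using r by (intro DERIV_cmult dilate flux_has_derivative w_cont mem) auto
    then have "((\<lambda>t. (- v' t) ^ N) has_real_derivative
        R ^ N * (real N * (R * r) ^ (N - 1) * h (w (R * r)) * R)) (at r within {0..1})"
      by (rule has_field_derivative_transform_within[OF _ zero_less_one])
         (use r mem in \<open>auto simp: v'_def power_mult_distrib slope_power[OF w_cont]\<close>)
    \<comment> \<open>One factor \<open>R ^ N\<close> comes from differentiating the dilated
      function, another from dilating the weight; together they give the power of
      \<open>R\<^sup>2\<close>.\<close>
    moreover have "R ^ N * (real N * (R * r) ^ (N - 1) * h (w (R * r)) * R) =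
        (4 * R\<^sup>2) ^ N * real N * r ^ (N - 1) * (v r) ^ N"
      using power_minus_mult[OF N_pos, of R] pos
      by (simp add: h_def v_def power_mult_distrib power2_eq_square max.absorb2)
    ultimately show ?thesis using r by (simp only: at_within_Icc_at greaterThanLessThan_iff)
  qed
  moreover have "v' 0 = 0" "v 1 = 0" using R by (auto simp: v'_def v_def)
  moreover have "0 < v r" if r: "r \<in> {0<..<1}" for r
    using w_strict_antimono[of "R * r" R] r R \<open>0 < R\<close> by (simp add: v_def)
  ultimately have "has_pos_eigenfunction N (4 * R\<^sup>2)"
    unfolding has_pos_eigenfunction_def by blast
  then show ?thesis using that[of "4 * R\<^sup>2"] \<open>0 < R\<close> by simp
qed

text \<open>Existence and uniqueness together justify the definite description in
  \<open>lambda1\<close>.\<close>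

lemma lambda1_pos_eigenvalue:
  assumes "N \<ge> 1"
  shows "0 < lambda1 N" "has_pos_eigenfunction N (lambda1 N)"
proof -
  have "\<exists>!\<mu>. 0 < \<mu> \<and> has_pos_eigenfunction N \<mu>"
    using pos_eigenvalue_exists[OF assms] pos_eigenvalue_unique[OF assms] by blast
  from theI'[OF this] show "0 < lambda1 N" "has_pos_eigenfunction N (lambda1 N)"
    unfolding lambda1_def by auto
qed

section \<open>Shooting\<close>

text \<open>If \<open>w 1\<close> were nonnegative, concavity would keep \<open>w\<close> above
  \<open>(1 - \<rho>) * e\<close> on \<open>{0..\<rho>}\<close>, where the bound on \<open>h\<close>
  holds. Dilating that interval to \<open>{0..1}\<close> gives a supersolution with parameter
  \<open>\<kappa> * \<rho>\<^sup>2\<close>, to be compared with the first eigenfunction.\<close>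

lemma (in profile) end_value_neg_of_superlinear:
  assumes "0 < \<rho>" "\<rho> < 1" "lambda1 N < \<kappa> * \<rho>\<^sup>2" "0 < \<kappa>"
    and large: "\<And>s. (1 - \<rho>) * e \<le> s \<Longrightarrow> (\<kappa> * s) ^ N \<le> h s"
  shows "w 1 < 0"
proof (rule ccontr)
  assume "\<not> w 1 < 0"
  interpret M: radial N "\<lambda>s. max 0 s ^ N" using N_ge by (rule radial_power)
  have above: "(1 - \<rho>) * e \<le> w r" if "r \<in> {0..\<rho>}" for r
  proof -
    have "(1 - \<rho>) * e \<le> (1 - r) * e" using that e_pos by (intro mult_right_mono) auto
    also have "\<dots> \<le> r * w 1 + (1 - r) * e" using that \<open>\<not> w 1 < 0\<close> by simp
    also have "\<dots> \<le> w r" using shoot_above_chord[OF w_cont, of r e] that assms by (simp flip: w_eq)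
    finally show ?thesis .
  qed
  have mem: "\<rho> * r \<in> {0..\<rho>}" if "r \<in> {0..1}" for r
    using that assms by (auto simp: mult_left_le)
  have mem1: "\<rho> * r \<in> {0..1}" if "r \<in> {0..1}" for r
    using that assms(1,2) by (auto intro: mult_le_one)
  note dilate = DERIV_dilate[OF less_imp_le[OF assms(1)] less_imp_le[OF assms(2)]]
  define y where "y r = w (\<rho> * r)" for r
  have y_pos: "0 < y r" if "r \<in> {0..1}" for r
  proof -
    have "0 < (1 - \<rho>) * e" using assms e_pos by simp
    then show ?thesis using above[OF mem[OF that]] by (simp add: y_def)
  qed
  have y_deriv: "(y has_real_derivative - slope N h w (\<rho> * r) * \<rho>) (at r within {0..1})"
    if "r \<in> {0..1}" for r
    unfolding y_def[abs_def] using that by (intro dilate w_has_derivative mem1)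
  have y_cont: "continuous_on {0..1} y" by (rule DERIV_continuous_on[OF y_deriv])
  have slope_ge: "\<kappa> * \<rho>\<^sup>2 * wnorm N y t \<le> \<rho> * slope N h w (\<rho> * t)" if t: "t \<in> {0..1}" for t
  proof -
    have "((\<lambda>s. \<rho> ^ N * (real N * (\<rho> * s) ^ (N - 1) * h (w (\<rho> * s)) * \<rho>)) has_integral
        \<rho> ^ N * flux N h w (\<rho> * t) - \<rho> ^ N * flux N h w (\<rho> * 0)) {0..t}"
    proof (rule fundamental_theorem_of_calculus)
      fix s assume s: "s \<in> {0..t}"
      have "((\<lambda>s. \<rho> ^ N * flux N h w (\<rho> * s)) has_real_derivative
          \<rho> ^ N * (real N * (\<rho> * s) ^ (N - 1) * h (w (\<rho> * s)) * \<rho>)) (at s within {0..1})"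
        using s t by (intro DERIV_cmult dilate flux_has_derivative w_cont mem1) auto
      then show "((\<lambda>s. \<rho> ^ N * flux N h w (\<rho> * s)) has_vector_derivative
          \<rho> ^ N * (real N * (\<rho> * s) ^ (N - 1) * h (w (\<rho> * s)) * \<rho>)) (at s within {0..t})"
        unfolding has_real_derivative_iff_has_vector_derivative[symmetric]
        by (rule DERIV_subset) (use t in auto)
    qed (use t in auto)
    then have "((\<lambda>s. \<rho> ^ N * (real N * (\<rho> * s) ^ (N - 1) * h (w (\<rho> * s)) * \<rho>)) has_integral
        \<rho> ^ N * flux N h w (\<rho> * t)) {0..t}" by simp
    then have "(\<kappa> * \<rho>\<^sup>2) ^ N * flux N (\<lambda>s. max 0 s ^ N) y t \<le> \<rho> ^ N * flux N h w (\<rho> * t)"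
    proof (rule has_integral_le[OF has_integral_mult_right[OF M.flux_has_integral[OF y_cont t]]])
      fix s assume "s \<in> {0..t}"
      then have s1: "s \<in> {0..1}" using t by auto
      have "(\<kappa> * \<rho>\<^sup>2) ^ N * (real N * s ^ (N - 1) * max 0 (y s) ^ N) =
          \<rho> ^ N * (real N * (\<rho> * s) ^ (N - 1) * (\<kappa> * y s) ^ N * \<rho>)"
        using power_minus_mult[OF N_pos, of \<rho>] y_pos[OF s1]
        by (simp add: power_mult_distrib power2_eq_square max.absorb2)
      also have "\<dots> \<le> \<rho> ^ N * (real N * (\<rho> * s) ^ (N - 1) * h (y s) * \<rho>)"
        using s1 assms large[OF above[OF mem[OF s1]]]
        by (intro mult_left_mono mult_right_mono) (auto simp: y_def)
      finally show "(\<kappa> * \<rho>\<^sup>2) ^ N * (real N * s ^ (N - 1) * max 0 (y s) ^ N) \<le>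
          \<rho> ^ N * (real N * (\<rho> * s) ^ (N - 1) * h (w (\<rho> * s)) * \<rho>)" by (simp add: y_def)
    qed
    then have "root N ((\<kappa> * \<rho>\<^sup>2) ^ N * flux N (\<lambda>s. max 0 s ^ N) y t) \<le>
        root N (\<rho> ^ N * flux N h w (\<rho> * t))"
      using N_pos by simp
    then show ?thesis
      using assms N_pos
      by (simp add: real_root_mult real_root_power_cancel wnorm_def slope_def del: real_root_le_iff)
  qed
  have y_super: "\<kappa> * \<rho>\<^sup>2 * integral {r..1} (wnorm N y) \<le> y r" if r: "r \<in> {0..1}" for r
  proof -
    have "((\<lambda>t. - slope N h w (\<rho> * t) * \<rho>) has_integral y 1 - y r) {r..1}"
    proof (rule fundamental_theorem_of_calculus)
      show "(y has_vector_derivative - slope N h w (\<rho> * x) * \<rho>) (at x within {r..1})"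
        if "x \<in> {r..1}" for x
        unfolding has_real_derivative_iff_has_vector_derivative[symmetric]
        by (rule DERIV_subset[OF y_deriv]) (use r that in auto)
    qed (use r in auto)
    from has_integral_neg[OF this]
    have upper: "((\<lambda>t. \<rho> * slope N h w (\<rho> * t)) has_integral y r - y 1) {r..1}"
      by (simp add: mult.commute)
    have lower: "((\<lambda>t. \<kappa> * \<rho>\<^sup>2 * wnorm N y t) has_integral
        \<kappa> * \<rho>\<^sup>2 * integral {r..1} (wnorm N y)) {r..1}"
      using r
      by (intro has_integral_mult_right integrable_integral wnorm_integrable N_ge y_cont) auto
    \<comment> \<open>The positive end value \<open>y 1 = w \<rho>\<close> may be dropped, as only
      an inequality is needed.\<close>
    have "\<kappa> * \<rho>\<^sup>2 * integral {r..1} (wnorm N y) \<le> y r - y 1"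
      by (rule has_integral_le[OF lower upper]) (use r slope_ge in auto)
    then show ?thesis using y_pos[of 1] by simp
  qed
  obtain v where v: "continuous_on {0..1} v" "\<And>r. r \<in> {0..<1} \<Longrightarrow> 0 < v r"
    "\<And>r. r \<in> {0..1} \<Longrightarrow> v r = lambda1 N * integral {r..1} (wnorm N v)"
    using pos_eigenfunction_integral_eq[OF N_ge lambda1_pos_eigenvalue[OF N_ge]] by blast
  have "\<kappa> * \<rho>\<^sup>2 \<le> lambda1 N"
    by (rule eigenvalue_comparison[OF N_ge v(1) y_cont v(2) y_pos _ y_super lambda1_pos_eigenvalue(1)[OF N_ge]])
       (auto simp flip: v(3))
  then show False using assms(3) by simp
qed

text \<open>The intermediate value theorem in the height gives approximants vanishing at 1, with
  heights in a fixed interval \<open>{c..D}\<close>. Since \<open>0 < c\<close>, their limit is not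
  the trivial solution.\<close>

lemma (in forcing) zero_boundary_profile_exists:
  assumes "0 < a" and small: "\<And>s. 0 < s \<Longrightarrow> s \<le> a \<Longrightarrow> h s \<le> (s / 2) ^ N"
    and "lambda1 N < \<kappa>" and large: "\<And>s. S \<le> s \<Longrightarrow> (\<kappa> * s) ^ N \<le> h s"
  obtains w e where "profile N h w e" "w 1 = 0"
proof -
  have l1: "0 < lambda1 N" by (rule lambda1_pos_eigenvalue[OF N_ge])
  \<comment> \<open>This makes \<open>\<kappa> * \<rho>\<^sup>2\<close> the midpoint of
    \<open>lambda1 N\<close> and \<open>\<kappa>\<close>.\<close>
  define \<rho> where "\<rho> = sqrt ((1 + lambda1 N / \<kappa>) / 2)"
  have \<rho>: "0 < \<rho>" "\<rho> < 1" "lambda1 N < \<kappa> * \<rho>\<^sup>2"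
    using l1 assms(3) by (auto simp: \<rho>_def field_simps real_sqrt_lt_1_iff intro!: real_sqrt_lt_1_iff[THEN iffD2])
  define D where "D = max S 1 / (1 - \<rho>)"
  have D: "0 < D" "S \<le> (1 - \<rho>) * D" using \<rho> by (auto simp: D_def)
  have "\<forall>\<^sub>F n in sequentially. approximant N h n D 1 < 0"
  \<comment> \<open>The comparison concerns true solutions, not delayed ones. Infinitely many
    nonnegative end values would produce in the limit a profile of height \<open>D\<close> with
    \<open>0 \<le> w 1\<close>.\<close>
  proof (rule ccontr)
    assume "\<not> ?thesis"
    then obtain \<sigma> where \<sigma>: "strict_mono (\<sigma> :: nat \<Rightarrow> nat)" "\<And>n. \<not> approximant N h (\<sigma> n) D 1 < 0"
      using not_eventually_sequentiallyD by blast
    obtain \<nu> e w where w: "strict_mono (\<nu> :: nat \<Rightarrow> nat)" "e \<in> {D..D}" "continuous_on {0..1} w"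
      "\<And>r. r \<in> {0..1} \<Longrightarrow> (\<lambda>n. approximant N h (\<sigma> (\<nu> n)) D r) \<longlonglongrightarrow> w r"
      "\<And>r. r \<in> {0..1} \<Longrightarrow> w r = shoot N h e w r"
      by (rule approximants_compact[OF \<sigma>(1), of "\<lambda>_. D" D D]) auto
    interpret profile N h w D
      using w D by unfold_locales auto
    have "w 1 < 0"
      using \<rho> l1 assms(3) D large by (intro end_value_neg_of_superlinear[of \<rho> \<kappa>]) auto
    moreover have "0 \<le> w 1"
      using \<sigma>(2) by (intro LIMSEQ_le_const[OF w(4)[of 1]]) (auto simp: not_less)
    ultimately show False by simp
  qed
  then obtain n0 where n0: "\<And>n. n0 \<le> n \<Longrightarrow> approximant N h n D 1 < 0"
    by (auto simp: eventually_sequentially)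
  define c where "c = min a D"
  have c: "0 < c" "c \<le> a" "c \<le> D" using assms D by (auto simp: c_def)
  \<comment> \<open>From height \<open>c\<close> the slope never exceeds \<open>c / 2\<close>, so at
    most half of the height is lost; this holds for every delay.\<close>
  have start: "0 < approximant N h n c 1" for n
  proof -
    let ?y = "\<lambda>s. approximant N h n c (max 0 (s - 1 / real (Suc n)))"
    have "slope N h ?y 1 \<le> root N ((c / 2) ^ N) * 1"
    proof (rule slope_upper[OF continuous_on_delayed_approximant])
      fix s :: real assume "s \<in> {0..1}"
      then have "max 0 (s - 1 / real (Suc n)) \<in> {0..1}" by (auto intro: order_trans[of _ s])
      then have le: "?y s \<le> c" by (rule approximant_le)
      show "h (?y s) \<le> (c / 2) ^ N"
      proof (cases "?y s \<le> 0")
        case True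
        then show ?thesis using c by (simp add: h_nonpos)
      next
        case False
        then have "h (?y s) \<le> (?y s / 2) ^ N" using le c by (intro small) auto
        also have "\<dots> \<le> (c / 2) ^ N" using le False by (intro power_mono) auto
        finally show ?thesis .
      qed
    qed auto
    then have "slope N h ?y 1 \<le> c / 2" using c real_root_power_cancel[OF N_pos, of "c / 2"] by simp
    then show ?thesis
      using shoot_drop_upper[OF continuous_on_delayed_approximant, of 0 1 c n c] c
      by (simp add: approximant_eq[of 1 n c])
  qed
  \<comment> \<open>The shift by \<open>n0\<close> skips the delays for which the end value from
    height \<open>D\<close> is not known to be negative.\<close>
  have "\<exists>d. d \<in> {c..D} \<and> approximant N h (n + n0) d 1 = 0" for n
    using IVT2'[of "\<lambda>d. approximant N h (n + n0) d 1" D 0 c] n0[of "n + n0"] start[of "n + n0"]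
      c continuous_on_approximant_start[of 1 c D "n + n0"] by auto
  then obtain d where d: "\<And>n. d n \<in> {c..D}" "\<And>n. approximant N h (n + n0) (d n) 1 = 0"
    by metis
  have shift: "strict_mono (\<lambda>n. n + n0)" by (auto simp: strict_mono_def)
  obtain \<nu> e w where w: "strict_mono (\<nu> :: nat \<Rightarrow> nat)" "e \<in> {c..D}" "continuous_on {0..1} w"
    "\<And>r. r \<in> {0..1} \<Longrightarrow> (\<lambda>n. approximant N h (\<nu> n + n0) (d (\<nu> n)) r) \<longlonglongrightarrow> w r"
    "\<And>r. r \<in> {0..1} \<Longrightarrow> w r = shoot N h e w r"
    by (rule approximants_compact[OF shift, of d c D, OF d(1)]) (rule that)
  show ?thesis
  proof (rule that)
    show "profile N h w e" using w c by unfold_locales auto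
    show "w 1 = 0" using w(4)[of 1] by (simp add: d(2) LIMSEQ_const_iff)
  qed
qed

section \<open>Strict convexity and the return to problem (MO)\<close>

lemma strictly_convex_on_of_deriv_strict_mono:
  fixes g g' :: "real \<Rightarrow> real"
  assumes deriv: "\<And>x. x \<in> {a<..<b} \<Longrightarrow> (g has_real_derivative g' x) (at x)"
    and mono: "\<And>x y. a < x \<Longrightarrow> x < y \<Longrightarrow> y < b \<Longrightarrow> g' x < g' y"
  shows "strictly_convex_on {a<..<b} g"
proof -
  have main: "g (t * x + (1 - t) * y) < t * g x + (1 - t) * g y"
    if xy: "a < x" "x < y" "y < b" and t: "0 < t" "t < 1" for x y t
  proof -
    define z where "z = t * x + (1 - t) * y"
    \<comment> \<open>These factors give the mean value slopes on both sides of \<open>z\<close> the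
      same weight \<open>t * (1 - t) * (y - x)\<close>.\<close>
    have zx: "z - x = (1 - t) * (y - x)" and yz: "y - z = t * (y - x)"
      by (simp_all add: z_def algebra_simps)
    have "0 < z - x" "0 < y - z" unfolding zx yz using xy t by simp_all
    then have z: "x < z" "z < y" by simp_all
    obtain p where p: "x < p" "p < z" "g z - g x = (z - x) * g' p"
      using MVT2[OF z(1), of g g'] deriv xy z by force
    obtain q where q: "z < q" "q < y" "g y - g z = (y - z) * g' q"
      using MVT2[OF z(2), of g g'] deriv xy z by force
    have "g' p < g' q" using mono[of p q] p q xy by simp
    then have "t * (1 - t) * (y - x) * g' p < t * (1 - t) * (y - x) * g' q"
      using xy t by (intro mult_strict_left_mono) auto
    then have "t * (g z - g x) < (1 - t) * (g y - g z)"
      unfolding p(3) q(3) zx yz by (simp add: mult_ac)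
    then show ?thesis unfolding z_def[symmetric] by (simp add: algebra_simps)
  qed
  show ?thesis
    unfolding strictly_convex_on_def
  proof (intro ballI allI impI)
    fix x y t :: real assume *: "x \<in> {a<..<b}" "y \<in> {a<..<b}" "x \<noteq> y \<and> 0 < t \<and> t < 1"
    show "g (t * x + (1 - t) * y) < t * g x + (1 - t) * g y"
      using main[of x y t] main[of y x "1 - t"] * by (cases "x < y") (auto simp: add.commute)
  qed
qed

context profile
begin

lemma w_pos:
  assumes "w 1 = 0" "r \<in> {0..<1}"
  shows "0 < w r"
  using w_strict_antimono[of r 1] assms by auto

lemma strictly_concave_w:
  assumes "w 1 = 0"
  shows "strictly_concave_on {0<..<1} w"
  unfolding strictly_concave_on_def
proof (rule strictly_convex_on_of_deriv_strict_mono[where g' = "slope N h w"])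
  show "((\<lambda>x. - w x) has_real_derivative slope N h w x) (at x)" if "x \<in> {0<..<1}" for x
    using DERIV_minus[OF w_has_derivative[of x]] that by (simp add: at_within_Icc_at)
  show "slope N h w x < slope N h w y" if "0 < x" "x < y" "y < 1" for x y
    unfolding slope_def using that N_pos assms
    by (auto intro!: flux_strict_mono w_cont h_pos w_pos)
qed

text \<open>The sign \<open>\<sigma>\<close> selects the branch: \<open>\<sigma> = -1\<close> gives the positive and \<open>\<sigma> = 1\<close> the negative solution.\<close>

lemma MO_solution_signed:
  assumes \<sigma>: "\<sigma> = 1 \<or> \<sigma> = -1" and "w 1 = 0"
    and h: "\<And>s. 0 < s \<Longrightarrow> h s = lam ^ N * (\<sigma> ^ N * f (\<sigma> * s))"
  shows "MO_solution N f lam (\<lambda>r. - \<sigma> * w r)"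
  unfolding MO_solution_def
proof (intro exI[of _ "\<lambda>r. \<sigma> * slope N h w r"] conjI ballI)
  obtain q where q: "continuous_on {0..1} q"
    "\<And>r. r \<in> {0..1} \<Longrightarrow> ((\<lambda>t. - slope N h w t) has_real_derivative q r) (at r within {0..1})"
    using C2_profile unfolding C2_with_deriv_def by blast
  show "C2_with_deriv (\<lambda>r. - \<sigma> * w r) (\<lambda>r. \<sigma> * slope N h w r)"
    unfolding C2_with_deriv_def
  proof (intro exI[of _ "\<lambda>r. - \<sigma> * q r"] conjI ballI)
    fix r :: real assume r: "r \<in> {0..1}"
    show "((\<lambda>r. - \<sigma> * w r) has_real_derivative \<sigma> * slope N h w r) (at r within {0..1})"
      using DERIV_cmult[OF w_has_derivative[OF r], of "- \<sigma>"] by simp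
    show "((\<lambda>r. \<sigma> * slope N h w r) has_real_derivative - \<sigma> * q r) (at r within {0..1})"
      using DERIV_cmult[OF q(2)[OF r], of "- \<sigma>"] by simp
  qed (intro continuous_intros q continuous_on_slope w_cont)+
  show "\<sigma> * slope N h w 0 = 0" "- \<sigma> * w 1 = 0" using assms by simp_all
  fix r :: real assume r: "r \<in> {0<..<1}"
  have "((\<lambda>t. \<sigma> ^ N * flux N h w t) has_real_derivative \<sigma> ^ N * (real N * r ^ (N - 1) * h (w r)))
      (at r within {0..1})"
    using r by (intro DERIV_cmult flux_has_derivative w_cont) auto
  then have "((\<lambda>t. (\<sigma> * slope N h w t) ^ N) has_real_derivative
      \<sigma> ^ N * (real N * r ^ (N - 1) * h (w r))) (at r within {0..1})"
    by (rule has_field_derivative_transform_within[OF _ zero_less_one])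
       (use r in \<open>auto simp: power_mult_distrib slope_power[OF w_cont]\<close>)
  \<comment> \<open>The power of the derivative and \<open>h\<close> each carry a factor
    \<open>\<sigma> ^ N\<close>; the two cancel.\<close>
  moreover have "\<sigma> ^ N * \<sigma> ^ N = 1" using \<sigma> by (auto simp flip: power_mult_distrib)
  then have "\<sigma> ^ N * (real N * r ^ (N - 1) * h (w r)) =
      lam ^ N * real N * r ^ (N - 1) * f (- (- \<sigma> * w r))"
    using h[OF w_pos[OF assms(2), of r]] r by (simp add: mult_ac)
  ultimately show "((\<lambda>t. (\<sigma> * slope N h w t) ^ N) has_real_derivative
      lam ^ N * real N * r ^ (N - 1) * f (- (- \<sigma> * w r))) (at r)"
    using r by (simp only: at_within_Icc_at greaterThanLessThan_iff)
qed

end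

text \<open>Reflecting \<open>f\<close> by \<open>\<sigma>\<close> turns both branches into one
  problem for a positive profile; the sign condition makes
  \<open>\<sigma> ^ N * f (\<sigma> * s)\<close> positive for \<open>0 < s\<close>.\<close>

lemma signed_solution_exists:
  fixes N :: nat and f :: "real \<Rightarrow> real" and f_inf lam \<sigma> :: real
  assumes N_ge: "N \<ge> 1"
    and f1_cont: "continuous_on UNIV f"
    and f1_sign: "\<forall>s. s \<noteq> 0 \<longrightarrow> f s * s ^ N > 0"
    and f0: "((\<lambda>s. f s / s ^ N) \<longlongrightarrow> 0) (at 0)"
    and finf_pos: "f_inf > 0"
    and finf: "((\<lambda>s. f s / s ^ N) \<longlongrightarrow> f_inf ^ N) at_infinity"
    and lam: "lam > lambda1 N / f_inf"
    and \<sigma>: "\<sigma> = 1 \<or> \<sigma> = -1"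
  obtains w where "MO_solution N f lam (\<lambda>r. - \<sigma> * w r)" "\<And>r. r \<in> {0<..<1} \<Longrightarrow> 0 < w r"
    "strictly_concave_on {0<..<1} w"
proof -
  have l1: "0 < lambda1 N" by (rule lambda1_pos_eigenvalue[OF N_ge])
  then have lam_pos: "0 < lam" using lam finf_pos by (auto intro: less_trans[rotated])
  have \<sigma>2: "\<sigma> ^ N * \<sigma> ^ N = 1" using \<sigma> by (auto simp flip: power_mult_distrib)
  \<comment> \<open>Needed for the extension \<open>h\<close> to vanish on the negative
    axis.\<close>
  have f_0: "f 0 = 0"
  proof (rule LIM_unique[where f = f and a = "0::real"])
    show "f \<midarrow>0\<rightarrow> f 0" using f1_cont by (auto simp: continuous_on_def)
    have "((\<lambda>s::real. s ^ N) \<longlongrightarrow> 0) (at 0)"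
      using N_ge by (auto intro!: tendsto_eq_intros simp: power_0_left)
    from tendsto_mult[OF f0 this] show "f \<midarrow>0\<rightarrow> 0"
      by (simp add: filterlim_cong[OF refl refl, of f "\<lambda>s. f s / s ^ N * s ^ N"] eventually_at_filter)
  qed
  define h where "h s = lam ^ N * (\<sigma> ^ N * f (\<sigma> * max 0 s))" for s
  have quot: "f (\<sigma> * s) / (\<sigma> * s) ^ N = \<sigma> ^ N * f (\<sigma> * s) / s ^ N" if "0 < s" for s
    by (simp add: power_mult_distrib divide_inverse inverse_unique[OF \<sigma>2])
  have g_pos: "0 < \<sigma> ^ N * f (\<sigma> * s)" if "0 < s" for s
  proof -
    have "0 < f (\<sigma> * s) * (\<sigma> * s) ^ N" using f1_sign that \<sigma> by auto
    also have "\<dots> = \<sigma> ^ N * f (\<sigma> * s) * s ^ N" by (simp add: power_mult_distrib)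
    finally show ?thesis by (rule zero_less_mult_pos2) (use that in simp)
  qed
  interpret forcing N h
  proof
    show "continuous_on UNIV h"
      unfolding h_def[abs_def]
      by (intro continuous_intros continuous_on_compose2[OF f1_cont]) auto
    show pos: "0 < h s" if "0 < s" for s
      using g_pos[OF that] lam_pos that by (simp add: h_def)
    show zero: "h s = 0" if "s \<le> 0" for s using that by (simp add: h_def f_0 max.absorb1)
    show "0 \<le> h s" for s using pos[of s] zero[of s] by (cases "s \<le> 0") auto
  qed (rule N_ge)
  have "\<forall>\<^sub>F s in at 0. f s / s ^ N < (1 / (2 * lam)) ^ N"
    using lam_pos by (intro order_tendstoD[OF f0]) simp
  then obtain a where a: "0 < a" "\<And>s. s \<noteq> 0 \<Longrightarrow> \<bar>s\<bar> < a \<Longrightarrow> f s / s ^ N < (1 / (2 * lam)) ^ N"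
    by (auto simp: eventually_at dist_real_def)
  \<comment> \<open>The threshold \<open>1 / (2 * lam)\<close> was chosen so that the factor
    \<open>lam\<close> leaves exactly \<open>s / 2\<close>. Halving \<open>a\<close> keeps the
    argument strictly inside the neighbourhood.\<close>
  have small: "h s \<le> (s / 2) ^ N" if "0 < s" "s \<le> a / 2" for s
  proof -
    have "\<sigma> ^ N * f (\<sigma> * s) / s ^ N < (1 / (2 * lam)) ^ N"
      unfolding quot[OF that(1), symmetric] using a(1) that \<sigma> by (intro a(2)) auto
    then have "\<sigma> ^ N * f (\<sigma> * s) \<le> (1 / (2 * lam)) ^ N * s ^ N"
      using that by (simp add: pos_divide_less_eq)
    then have "lam ^ N * (\<sigma> ^ N * f (\<sigma> * s)) \<le> lam ^ N * ((1 / (2 * lam)) ^ N * s ^ N)"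
      using lam_pos by (intro mult_left_mono) auto
    also have "\<dots> = (lam * (1 / (2 * lam) * s)) ^ N" by (simp only: power_mult_distrib)
    also have "\<dots> = (s / 2) ^ N" using lam_pos by simp
    finally show ?thesis using that by (simp add: h_def max.absorb2)
  qed
  have "lambda1 N < lam * f_inf" using lam finf_pos by (simp only: pos_divide_less_eq)
  \<comment> \<open>The gap below \<open>lam * f_inf\<close> absorbs the error in the limit at
    infinity; the gap above \<open>lambda1 N\<close> leaves room for \<open>\<rho> < 1\<close> in
    the shooting.\<close>
  then obtain \<kappa> where \<kappa>: "lambda1 N < \<kappa>" "\<kappa> < lam * f_inf"
    using dense by blast
  have "(\<kappa> / lam) ^ N < f_inf ^ N"
    using \<kappa> l1 lam_pos N_ge by (intro power_strict_mono) (auto simp: pos_divide_less_eq mult.commute[of f_inf])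
  then have "\<forall>\<^sub>F s in at_infinity. (\<kappa> / lam) ^ N < f s / s ^ N"
    by (rule order_tendstoD(1)[OF finf])
  then obtain b where b: "\<And>s. b \<le> \<bar>s\<bar> \<Longrightarrow> (\<kappa> / lam) ^ N < f s / s ^ N"
    by (auto simp: eventually_at_infinity)
  have large: "(\<kappa> * s) ^ N \<le> h s" if "max b 1 \<le> s" for s
  proof -
    have "0 < s" using that by simp
    have "(\<kappa> / lam) ^ N < \<sigma> ^ N * f (\<sigma> * s) / s ^ N"
      unfolding quot[OF \<open>0 < s\<close>, symmetric] using that \<sigma> by (intro b) auto
    then have "(\<kappa> / lam) ^ N * s ^ N \<le> \<sigma> ^ N * f (\<sigma> * s)"
      using \<open>0 < s\<close> by (simp add: pos_less_divide_eq)
    then have "lam ^ N * ((\<kappa> / lam) ^ N * s ^ N) \<le> h s"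
      using lam_pos \<open>0 < s\<close> unfolding h_def by (simp add: max.absorb2)
    moreover have "lam ^ N * ((\<kappa> / lam) ^ N * s ^ N) = (lam * (\<kappa> / lam * s)) ^ N"
      by (simp only: power_mult_distrib)
    ultimately show ?thesis using lam_pos by simp
  qed
  obtain w e where "profile N h w e" and w1: "w 1 = 0"
    using zero_boundary_profile_exists[of "a / 2" \<kappa> "max b 1"] a(1) small \<kappa>(1) large by auto
  then interpret profile N h w e by simp
  show ?thesis
  proof (rule that)
    show "MO_solution N f lam (\<lambda>r. - \<sigma> * w r)"
      by (rule MO_solution_signed[OF \<sigma> w1]) (simp add: h_def max.absorb2)
    show "strictly_concave_on {0<..<1} w" by (rule strictly_concave_w[OF w1])
  qed (use w_pos[OF w1] in auto)
qed

theorem theorem4p4: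
  fixes N :: nat and f :: "real \<Rightarrow> real" and f_inf lam :: real
  assumes N_ge: "N \<ge> 1"
    and f1_cont: "continuous_on UNIV f"
    and f1_sign: "\<forall>s. s \<noteq> 0 \<longrightarrow> f s * s ^ N > 0"
    and f0: "((\<lambda>s. f s / s ^ N) \<longlongrightarrow> 0) (at 0)"
    and finf_pos: "f_inf > 0"
    and finf: "((\<lambda>s. f s / s ^ N) \<longlongrightarrow> f_inf ^ N) at_infinity"
    and lam: "lam > lambda1 N / f_inf"
  shows "\<exists>u_plus u_minus.
           MO_solution N f lam u_plus \<and> (\<forall>r\<in>{0<..<1}. u_plus r > 0) \<and>
           strictly_concave_on {0<..<1} u_plus \<and>
           MO_solution N f lam u_minus \<and> (\<forall>r\<in>{0<..<1}. u_minus r < 0) \<and>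
           strictly_convex_on {0<..<1} u_minus"
proof -
  note exists = signed_solution_exists[OF assms]
  obtain p where "MO_solution N f lam (\<lambda>r. - (-1) * p r)" "\<And>r. r \<in> {0<..<1} \<Longrightarrow> 0 < p r"
    "strictly_concave_on {0<..<1} p"
    by (rule exists[of "-1"]) auto
  moreover obtain m where "MO_solution N f lam (\<lambda>r. - 1 * m r)" "\<And>r. r \<in> {0<..<1} \<Longrightarrow> 0 < m r"
    "strictly_concave_on {0<..<1} m"
    by (rule exists[of 1]) auto
  ultimately show ?thesis
    by (intro exI[of _ p] exI[of _ "\<lambda>r. - m r"]) (auto simp: strictly_concave_on_def)
qed

end
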